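(* Let $d\ge2$ and let $p$ be prime. Then: (1) Every point of $\mathscr C_d\cup\mathscr G_p$ is visible from the origin. Any two distinct points of $\mathscr G_p$ are visible from each other. If $d=p-1$ and $p$ is large enough, any two distinct points of $\mathscr C_{p-1}\cup\mathscr G_p$ are visible from each other. (2) As $d\to\infty$, the limit set of the normalized distances between distinct points of $\mathscr C_d$ is the interval $[0,1/2]$. (3) As $p\to\infty$, the limit set of the normalized distances between distinct points of $\mathscr G_p$ is $\{1/\sqrt6\}$. (4) With $d=p-1$, as $p\to\infty$, the limit set of the normalized distances between points $\mathfrak c\in\mathscr C_{p-1}$ and $\mathfrak g\in\mathscr G_p$ is $\{1/\sqrt6\}$. (5) As $d\to\infty$, the limit set of $\operatorname{Spec}(\mathscr C_d)$ is the interval $[0,\sqrt{39}/8]$. (6) As $p\to\infty$, the limit set of $\operatorname{Spec}(\mathscr G_p)$ is $\{\sqrt7/4\}$. (7) With $d=p-1$, as $p\to\infty$, the limit set of $\operatorname{Spec}(\mathscr C_{p-1},\mathscr G_p)$ is $\{\sqrt7/4\}$.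
   Context: For $d\ge2$, $\mathscr C_d=\{\mathfrak c_0,\dots,\mathfrak c_d\}\subset\mathbb Z^{d+1}$, where $\mathfrak c_h=(r(h),r(h+1),\dots,r(h+d))$ and $r(m)\in\{0,\dots,d\}$ is the residue of $m$ modulo $d+1$ (the rows of the circulant matrix with first row $(0,1,\dots,d)$). For a prime $p$, $\mathscr G_p=\{\mathfrak g_0,\dots,\mathfrak g_{p-1}\}\subset\mathbb Z^p$, where $\mathfrak g_h=(\iota(h),\iota(h+1),\dots,\iota(h+p-1))$, with $\iota(m)\in\{1,\dots,p-1\}$ the inverse of $m$ modulo $p$ if $p\nmid m$, and $\iota(m)=0$ if $p\mid m$. A lattice point $\mathbf v$ is visible from the origin if the gcd of its coordinates is $1$; two lattice points $\mathbf v,\mathbf w$ are visible from each other if the gcd of the coordinates of $\mathbf v-\mathbf w$ is $1$. The normalized distance between points of $\mathbb Z^{d+1}$ with coordinates in $[0,d]$ (e.g. points of $\mathscr C_d$, or of $\mathscr C_{p-1}\cup\mathscr G_p$ with $d=p-1$) is their Euclidean distance divided by $d^{3/2}$. For sets $\mathscr M',\mathscr M''$ of nonzero points, $\operatorname{Spec}(\mathscr M',\mathscr M'')$ is the set of sines of the angles between the rays from the origin through $\mathfrak m'$ and through $\mathfrak m''$, over all $\mathfrak m'\in\mathscr M'$, $\mathfrak m''\in\mathscr M''$ with $\mathfrak m'\ne\mathfrak m''$; $\operatorname{Spec}(\mathscr M)=\operatorname{Spec}(\mathscr M,\mathscr M)$. For a family of finite sets $S_n\subset\mathbb R$ indexed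 by $n\to\infty$ (with $n=d$, or $n=p$ running over primes), the limit set is the set of $y\in\mathbb R$ for which there exist $n_k\to\infty$ and $x_k\in S_{n_k}$ with $x_k\to y$. *)

theory Defs
  imports
    "Jordan_Normal_Form.Matrix"
    "HOL-Analysis.L2_Norm"
    "HOL-Number_Theory.Modular_Inverse"
    "HOL-Computational_Algebra.Primes"
begin

(* Lattice points of Z^n are the integer vectors in carrier_vec n; the dimension belongs to
   the value rather than to the type, since it has to tend to infinity. *)

definition circ_point :: "nat \<Rightarrow> nat \<Rightarrow> int vec" where
  "circ_point d h = vec (d + 1) (\<lambda>j. int ((h + j) mod (d + 1)))"

definition circ_set :: "nat \<Rightarrow> int vec set" where
  "circ_set d = circ_point d ` {0..d}"

(* For prime p, modular_inverse p m is the inverse of m in {1..p-1} if p does not divide m,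
   and it is 0 by convention if p divides m. *)
definition inv_point :: "nat \<Rightarrow> nat \<Rightarrow> int vec" where
  "inv_point p h = vec p (\<lambda>j. modular_inverse (int p) (int (h + j)))"

definition inv_set :: "nat \<Rightarrow> int vec set" where
  "inv_set p = inv_point p ` {0..<p}"

definition visible_from_origin :: "int vec \<Rightarrow> bool" where
  "visible_from_origin v \<longleftrightarrow> Gcd (vec_set v) = 1"

definition mutually_visible :: "int vec \<Rightarrow> int vec \<Rightarrow> bool" where
  "mutually_visible v w \<longleftrightarrow> Gcd (vec_set (v - w)) = 1"

definition euclid_norm :: "int vec \<Rightarrow> real" where
  "euclid_norm v = L2_set (\<lambda>i. real_of_int (v $ i)) {..<dim_vec v}"

definition normalized_dist :: "nat \<Rightarrow> int vec \<Rightarrow> int vec \<Rightarrow> real" where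
  "normalized_dist d v w = euclid_norm (v - w) / real d powr (3 / 2)"

definition ray_angle :: "int vec \<Rightarrow> int vec \<Rightarrow> real" where
  "ray_angle v w = arccos (real_of_int (v \<bullet> w) / (euclid_norm v * euclid_norm w))"

definition Spec2 :: "int vec set \<Rightarrow> int vec set \<Rightarrow> real set" where
  "Spec2 M N = {sin (ray_angle v w) | v w. v \<in> M \<and> w \<in> N \<and> v \<noteq> w}"

abbreviation Spec :: "int vec set \<Rightarrow> real set" where
  "Spec M \<equiv> Spec2 M M"

(* I is the set of admissible indices of the family S: all d \<ge> 2, or primes. *)
definition limit_set :: "nat set \<Rightarrow> (nat \<Rightarrow> real set) \<Rightarrow> real set" where
  "limit_set I S = {y. \<exists>n x. filterlim n at_top sequentially \<and>
     (\<forall>k. n k \<in> I \<and> x k \<in> S (n k)) \<and> x \<longlonglongrightarrow> y}"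

end

(* Every point of the two families with d = p - 1 has coordinates permuting 0, ..., p-1, so all
   norms agree and distances and angles depend only on scalar products.

   Two points of the circulant family that differ by a shift t, with n = d + 1, have squared
   distance n t (n - t). Hence the normalized distances fill up the values of
   sqrt (x (1 - x)), and the cosines those of 1 - (3/2) x (1 - x), for x in [0, 1].

   In the other cases the scalar product is p^3/4 + o(p^3), because residues and inverses are
   uncorrelated: the Fourier expansion of the sawtooth function (whose coefficients have absolute
   sum O(p log p)) turns the correlation into Kloosterman sums. Those are O(p^(3/4)) by
   Kloosterman's argument: the sum K(m, n) depends only on m n, so each value occurs p - 1 times
   in the fourth moment over all (m, n), which counts the solutions of x + y = z + w,
   1/x + 1/y = 1/z + 1/w.

   A common divisor of all coordinates of a difference must divide the jump at the wrap-around of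
   the residues; comparing a few explicit inverses (of 2, 3, 4, powers of 2 and 12) rules it out. *)

theory Submission
  imports Defs "HOL-Library.Real_Mod" "HOL-Real_Asymp.Real_Asymp"
begin

subsection \<open>Elementary estimates\<close>

text \<open>Scalar products are needed only up to o(p^3). The two Fourier expansions cost the square
  of O(p log p), so any power saving over the trivial bound p for a Kloosterman sum is enough;
  p^(3/4) leaves p^(11/4) (log p)^2. The fourth moment is the first even one with such a saving: the
  second moment counts only the solutions of x = z, equals p^2 (p - 1), and after division by the p
  - 1 equal terms returns |K| \<le> p.

  A product of 1/x and 1/(x + h) is not of Kloosterman type. A fractional linear change of variable
  makes one factor affine in z and the other affine in 1/z, up to two exceptional values; hence
  correlations are estimated for arbitrary affine arguments.

  Visibility between the two families can fail for a small prime: for p = 7 inversion preserves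
  parity on {0, ..., 6}, and the coordinates of \<open>circ_point 6 0 - inv_point 7 0\<close> have
  gcd 2.\<close>

lemma half_le_sin:
  fixes t :: real
  assumes "0 \<le> t" "t \<le> pi / 2"
  shows "t / 2 \<le> sin t"
proof -
  \<comment> \<open>With u = t/2: sin t = 2 sin u cos u \<ge> 2 u (cos u)^2, and (cos u)^2 \<ge> 1/2
    because u \<le> pi/4.\<close>
  have "cos (pi/4) \<le> cos (t/2)"
    using assms by (intro cos_monotone_0_pi_le) auto
  hence c: "sqrt 2 / 2 \<le> cos (t/2)" by (simp add: cos_45)
  have "(1/2::real) \<le> (cos (t/2))\<^sup>2"
    using power_mono[OF c, of 2] by (simp add: power_divide)
  moreover have "sin t = 2 * sin (t/2) * cos (t/2)"
    using sin_double[of "t/2"] by simp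
  moreover have "t/2 * cos (t/2) \<le> sin (t/2)"
  proof -
    have "sin 0 - 0 * cos 0 \<le> sin (t/2) - t/2 * cos (t/2)"
    proof (rule DERIV_nonneg_imp_nondecreasing[where f = "\<lambda>x. sin x - x * cos x"])
      show "0 \<le> t / 2" using assms by simp
      fix x assume x: "0 \<le> x" "x \<le> t/2"
      have "((\<lambda>x. sin x - x * cos x) has_real_derivative x * sin x) (at x)"
        by (auto intro!: derivative_eq_intros)
      moreover have "0 \<le> x * sin x"
        using x assms pi_gt_zero by (intro mult_nonneg_nonneg sin_ge_zero) linarith+
      ultimately show "\<exists>y. ((\<lambda>x. sin x - x * cos x) has_real_derivative y) (at x) \<and> 0 \<le> y"
        by blast
    qed
    thus ?thesis by simp
  qed
  hence "t/2 * cos (t/2) * cos (t/2) \<le> sin (t/2) * cos (t/2)"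
  proof (rule mult_right_mono)
    have "0 \<le> sqrt 2 / (2::real)" by simp
    with c show "0 \<le> cos (t/2)" by (rule order_trans[rotated])
  qed
  moreover have "t * (1/2) \<le> t * (cos (t/2))\<^sup>2"
    by (intro mult_left_mono) (use assms calculation(1) in auto)
  ultimately show ?thesis by (simp add: power2_eq_square)
qed

text \<open>The differentiated geometric sum with its denominator cleared, hence valid in every
  commutative ring. For \<open>w ^ n = 1\<close> the right-hand side collapses to n (w - 1).\<close>

lemma sum_index_power:
  fixes w :: "'a :: comm_ring_1"
  shows "(w - 1)\<^sup>2 * (\<Sum>y<n. of_nat y * w ^ y) = (of_nat n - 1) * w ^ (n + 1) - of_nat n * w ^ n + w"
  by (induction n) (simp_all add: algebra_simps power2_eq_square)

lemma norm_cis_diff_1: "cmod (cis t - 1) = 2 * \<bar>sin (t / 2)\<bar>"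
proof (rule power2_eq_imp_eq)
  have "(cmod (cis t - 1))\<^sup>2 = (cos t)\<^sup>2 + (sin t)\<^sup>2 + 1 - 2 * cos t"
    by (simp add: cmod_power2 power2_diff)
  also have "\<dots> = 2 - 2 * cos (2 * (t / 2))" by simp
  also have "\<dots> = (2 * \<bar>sin (t / 2)\<bar>)\<^sup>2"
    by (simp only: cos_double_sin) (simp add: power_mult_distrib)
  finally show "(cmod (cis t - 1))\<^sup>2 = (2 * \<bar>sin (t / 2)\<bar>)\<^sup>2" .
qed auto

lemma sum_reciprocals_le_ln:
  assumes "n > 0"
  shows "(\<Sum>m=1..n. 1 / real m) \<le> 1 + ln (real n)"
  using assms
proof (induction n rule: nat_induct_non_zero)
  case (Suc n)
  have "ln (real n / (real n + 1)) \<le> real n / (real n + 1) - 1"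
    using Suc.hyps by (intro ln_le_minus_one) simp
  also have "\<dots> = - (1 / (real n + 1))" by (simp add: field_simps)
  finally have "ln (real n) + 1 / (real n + 1) \<le> ln (real n + 1)"
    using Suc.hyps by (simp add: ln_div)
  thus ?case using Suc.IH by (simp add: add.commute)
qed simp

lemma sum_reciprocal_pairs_le:
  assumes "n > 0"
  shows "(\<Sum>m=1..<n. 1 / real m + 1 / (real n - real m)) \<le> 2 * (1 + ln (real n))"
proof -
  have "(\<Sum>m=1..<n. 1 / (real n - real m)) = (\<Sum>m=1..<n. 1 / real m)"
    by (rule sum.reindex_bij_witness[where i = "\<lambda>m. n - m" and j = "\<lambda>m. n - m"]) (auto simp: of_nat_diff)
  hence "(\<Sum>m=1..<n. 1 / real m + 1 / (real n - real m)) = 2 * (\<Sum>m=1..<n. 1 / real m)"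
    by (simp add: sum.distrib)
  also have "(\<Sum>m=1..<n. 1 / real m) \<le> (\<Sum>m=1..n. 1 / real m)"
    by (intro sum_mono2) auto
  also have "\<dots> \<le> 1 + ln (real n)" using assms by (rule sum_reciprocals_le_ln)
  finally show ?thesis by simp
qed

subsection \<open>Kloosterman sums\<close>

locale prime_modulus =
  fixes p :: int
  assumes prime_p: "prime p"
begin

section \<open>Additive characters modulo p\<close>

definition e :: "int \<Rightarrow> complex" where
  "e x = cis (2 * pi * real_of_int x / real_of_int p)"

abbreviation "R \<equiv> {0..<p}"
abbreviation "U \<equiv> {1..<p}"
abbreviation "inv_p \<equiv> modular_inverse p"

lemma p_gt_1: "p > 1"
  using prime_p prime_gt_1_int by blast

lemma p_pos: "p > 0" using p_gt_1 by simp

lemma coprime_iff: "coprime x p \<longleftrightarrow> \<not> p dvd x"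
  using prime_p prime_imp_coprime[of p x] coprime_absorb_left[of p x] p_gt_1
  by (auto simp: coprime_commute)

lemma U_not_dvd: "x \<in> U \<Longrightarrow> \<not> p dvd x"
  by (simp add: zdvd_not_zless)

lemma e_add: "e (x + y) = e x * e y"
  by (simp add: e_def cis_mult add_divide_distrib distrib_left)

lemma e_0 [simp]: "e 0 = 1"
  by (simp add: e_def)

lemma norm_e [simp]: "cmod (e x) = 1"
  by (simp add: e_def)

lemma cnj_e: "cnj (e x) = e (- x)"
  by (simp add: e_def cis_cnj)

lemma e_eq_1_iff: "e x = 1 \<longleftrightarrow> p dvd x"
proof -
  have "e x = 1 \<longleftrightarrow> (\<exists>n. real_of_int x = real_of_int (n * p))"
    using p_pos by (simp add: e_def cis_eq_1_iff field_simps)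
  also have "\<dots> \<longleftrightarrow> p dvd x"
    by (auto simp: of_int_eq_iff dvd_def mult.commute simp del: of_int_mult)
  finally show ?thesis .
qed

lemma e_cong: "[x = y] (mod p) \<Longrightarrow> e x = e y"
  using e_add[of "x - y" y] e_eq_1_iff[of "x - y"] by (simp add: cong_iff_dvd_diff)

lemma e_power: "e x ^ k = e (int k * x)"
  by (induction k) (simp_all add: e_add distrib_right)

lemma R_eq: "R = int ` {..<nat p}"
  using p_pos image_int_atLeastLessThan[of 0 "nat p"] by (simp add: atLeast0LessThan)

lemma sum_R: "(\<Sum>m\<in>R. f m) = (\<Sum>k<nat p. f (int k))"
  by (simp add: R_eq sum.reindex)

lemma sum_R_split: "(\<Sum>m\<in>R. f m) = f 0 + (\<Sum>m\<in>U. f m)"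
proof -
  have "R = insert 0 U" using p_pos by auto
  thus ?thesis by simp
qed

lemma sum_e: "(\<Sum>m\<in>R. e (m * x)) = (if p dvd x then of_int p else 0)"
proof -
  have "(\<Sum>m\<in>R. e (m * x)) = (\<Sum>k<nat p. e x ^ k)"
    by (simp add: sum_R e_power)
  also have "\<dots> = (if p dvd x then of_int p else 0)"
  proof (cases "p dvd x")
    case True
    thus ?thesis using p_pos by (simp add: e_eq_1_iff[THEN iffD2])
  next
    case False
    have "e x ^ nat p = 1"
      using p_pos by (simp add: e_power e_eq_1_iff)
    thus ?thesis using False by (simp add: geometric_sum e_eq_1_iff)
  qed
  finally show ?thesis .
qed

text \<open>Expanding the square and using orthogonality in m and in n leaves the pairs on which
  both phases agree, each with weight p^2. This turns a moment of exponential sums into a number of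
  solutions.\<close>

lemma sum_norm_square_e:
  fixes u v :: "'a \<Rightarrow> int"
  assumes "finite Q"
  shows "(\<Sum>m\<in>R. \<Sum>n\<in>R. (cmod (\<Sum>q\<in>Q. e (m * u q + n * v q)))\<^sup>2) =
         (real_of_int p)\<^sup>2 * real (card {(q, q'). q \<in> Q \<and> q' \<in> Q \<and> [u q = u q'] (mod p) \<and> [v q = v q'] (mod p)})"
    (is "?L = ?P * real (card ?C)")
proof -
  have C: "?C = {z \<in> Q \<times> Q. p dvd u (fst z) - u (snd z) \<and> p dvd v (fst z) - v (snd z)}"
    by (auto simp: cong_iff_dvd_diff)
  have "complex_of_real ?L = (\<Sum>m\<in>R. \<Sum>n\<in>R. (\<Sum>q\<in>Q. e (m * u q + n * v q)) * cnj (\<Sum>q\<in>Q. e (m * u q + n * v q)))"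
    by (simp only: of_real_sum complex_norm_square)
  also have "\<dots> = (\<Sum>m\<in>R. \<Sum>n\<in>R. \<Sum>z\<in>Q\<times>Q. e (m * (u (fst z) - u (snd z))) * e (n * (v (fst z) - v (snd z))))"
    by (simp add: cnj_e sum_product sum.cartesian_product case_prod_unfold flip: e_add)
       (simp add: algebra_simps)
  also have "\<dots> = (\<Sum>z\<in>Q\<times>Q. (\<Sum>m\<in>R. e (m * (u (fst z) - u (snd z)))) * (\<Sum>n\<in>R. e (n * (v (fst z) - v (snd z)))))"
  proof -
    have "(\<Sum>m\<in>R. \<Sum>n\<in>R. \<Sum>z\<in>Q\<times>Q. F m n z) = (\<Sum>z\<in>Q\<times>Q. \<Sum>m\<in>R. \<Sum>n\<in>R. F m n z)"
      for F :: "int \<Rightarrow> int \<Rightarrow> 'a \<times> 'a \<Rightarrow> complex"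
    proof -
      have "(\<Sum>m\<in>R. \<Sum>n\<in>R. \<Sum>z\<in>Q\<times>Q. F m n z) = (\<Sum>m\<in>R. \<Sum>z\<in>Q\<times>Q. \<Sum>n\<in>R. F m n z)"
        by (intro sum.cong refl sum.swap)
      also have "\<dots> = (\<Sum>z\<in>Q\<times>Q. \<Sum>m\<in>R. \<Sum>n\<in>R. F m n z)" by (rule sum.swap)
      finally show ?thesis .
    qed
    thus ?thesis by (simp add: sum_product)
  qed
  also have "\<dots> = (\<Sum>z\<in>Q\<times>Q. if p dvd u (fst z) - u (snd z) \<and> p dvd v (fst z) - v (snd z) then (of_int p)\<^sup>2 else 0)"
    by (intro sum.cong) (auto simp: sum_e power2_eq_square)
  also have "\<dots> = of_real (?P * real (card ?C))"
    using assms by (simp add: sum.If_cases C Int_def conj_commute)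
  finally show ?thesis using of_real_eq_iff by blast
qed

section \<open>Inverses modulo p\<close>

lemma inv_in_R: "inv_p x \<in> R"
  using p_pos by (simp add: modular_inverse_int_nonneg modular_inverse_int_less)

lemma inv_of_multiple: "p dvd x \<Longrightarrow> inv_p x = 0"
  by (simp add: coprime_iff)

lemma inv_cong1: "\<not> p dvd x \<Longrightarrow> [x * inv_p x = 1] (mod p)"
  by (simp add: coprime_iff cong_modular_inverse1)

lemma inv_in_U: "\<not> p dvd x \<Longrightarrow> inv_p x \<in> U"
  using inv_in_R[of x] mult_modular_inverse_int_pos[of p x] p_gt_1 coprime_iff[of x] by simp

lemma inv_eqI: "[x * y = 1] (mod p) \<Longrightarrow> inv_p x = y mod p"
  using p_pos by (intro modular_inverse_int_eqI) (auto simp: Cong.cong_def mod_mult_right_eq)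

lemma inv_cong:
  assumes "[x = y] (mod p)"
  shows "inv_p x = inv_p y"
proof (cases "p dvd x")
  case True
  thus ?thesis using assms by (simp add: inv_of_multiple cong_dvd_iff)
next
  case False
  have "[y * inv_p x = x * inv_p x] (mod p)"
    by (rule cong_scalar_right[OF cong_sym[OF assms]])
  hence "[y * inv_p x = 1] (mod p)"
    using inv_cong1[OF False] by (rule cong_trans)
  hence "inv_p y = inv_p x mod p" by (rule inv_eqI)
  thus ?thesis using inv_in_R[of x] by simp
qed

lemma inv_mult: "inv_p (x * y) = inv_p x * inv_p y mod p"
proof (cases "p dvd x \<or> p dvd y")
  case True
  thus ?thesis by (auto simp: inv_of_multiple)
next
  case False
  thus ?thesis using modular_inverse_int_mult[of x p y] p_pos coprime_iff[of x] coprime_iff[of y] by (simp add: mult.commute)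
qed

text \<open>Since multiples of p get the inverse 0, inversion is an involution on all residues and
  can serve as a substitution in sums over the whole of \<open>R\<close>.\<close>

lemma inv_inv: "inv_p (inv_p x) = x mod p"
proof (cases "p dvd x")
  case True
  thus ?thesis by (auto simp: inv_of_multiple)
next
  case False
  thus ?thesis by (intro inv_eqI) (metis inv_cong1 mult.commute)
qed

section \<open>Kloosterman sums and their fourth moment\<close>

definition kloosterman :: "int \<Rightarrow> int \<Rightarrow> complex" where
  "kloosterman m n = (\<Sum>x\<in>U. e (m * x + n * inv_p x))"

lemma kloosterman_cong: "[m = m'] (mod p) \<Longrightarrow> [n = n'] (mod p) \<Longrightarrow> kloosterman m n = kloosterman m' n'"
  unfolding kloosterman_def by (intro sum.cong e_cong cong_add cong_mult) auto

lemma kloosterman_dilate: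
  assumes "t \<in> U"
  shows "kloosterman (m * t) (n * inv_p t) = kloosterman m n"
proof -
  have b: "bij_betw (\<lambda>y. t * y mod p) U U"
    by (rule bij_betw_int_remainders_mult) (use assms U_not_dvd in \<open>auto simp: coprime_iff\<close>)
  have "kloosterman m n = (\<Sum>y\<in>U. e (m * (t * y mod p) + n * inv_p (t * y mod p)))"
    unfolding kloosterman_def by (rule sum.reindex_bij_betw[OF b, symmetric])
  also have "\<dots> = (\<Sum>y\<in>U. e (m * t * y + n * inv_p t * inv_p y))"
  proof (intro sum.cong e_cong cong_add refl)
    fix y
    show "[m * (t * y mod p) = m * t * y] (mod p)"
      by (simp add: Cong.cong_def mod_mult_right_eq mult.assoc)
    have "inv_p (t * y mod p) = inv_p t * inv_p y mod p"
      using inv_cong[of "t * y mod p" "t * y"] by (simp add: inv_mult)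
    thus "[n * inv_p (t * y mod p) = n * inv_p t * inv_p y] (mod p)"
      by (simp add: Cong.cong_def mod_mult_right_eq mult.assoc)
  qed
  finally show ?thesis by (simp add: kloosterman_def)
qed

lemma inv_multiple:
  assumes "x \<in> U"
  obtains k where "x * inv_p x = 1 + p * k"
proof -
  have "p dvd x * inv_p x - 1"
    using inv_cong1[OF U_not_dvd[OF assms]] by (simp only: cong_iff_dvd_diff)
  then obtain k where "x * inv_p x - 1 = p * k" by (elim dvdE)
  thus ?thesis by (intro that[of k]) simp
qed

lemma U_eqI:
  assumes "p dvd a - b" "a \<in> U" "b \<in> U"
  shows "a = b"
proof -
  have "a mod p = b mod p" using assms(1) by (simp add: mod_eq_dvd_iff)
  thus ?thesis using assms(2,3) by simp
qed

text \<open>Let s = x + y = z + w. As 1/x + 1/y = s/(xy), the second congruence says s (zw - xy) = 0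
  modulo p. If s = 0, each pair consists of a residue and its negative. Otherwise both pairs have
  the same sum and product, so they are the roots of one quadratic.\<close>

lemma sum_and_inverse_sum_cases:
  assumes U: "x \<in> U" "y \<in> U" "z \<in> U" "w \<in> U"
    and s: "[x + y = z + w] (mod p)" and i: "[inv_p x + inv_p y = inv_p z + inv_p w] (mod p)"
  shows "z = x \<and> w = y \<or> z = y \<and> w = x \<or> y = p - x \<and> w = p - z"
proof -
  have comp: "b = p - a" if "p dvd a + b" "a \<in> U" "b \<in> U" for a b
  proof (rule U_eqI)
    have "p dvd (a + b) - p" using that(1) by (intro dvd_diff) simp_all
    thus "p dvd b - (p - a)" by (simp add: algebra_simps)
  qed (use that in auto)
  obtain X where X: "x * inv_p x = 1 + p * X" by (rule inv_multiple[OF U(1)])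
  obtain Y where Y: "y * inv_p y = 1 + p * Y" by (rule inv_multiple[OF U(2)])
  obtain Z where Z: "z * inv_p z = 1 + p * Z" by (rule inv_multiple[OF U(3)])
  obtain W where W: "w * inv_p w = 1 + p * W" by (rule inv_multiple[OF U(4)])
  have s_dvd: "p dvd (x + y) - (z + w)" using s by (simp only: cong_iff_dvd_diff)
  then obtain s' where "(x + y) - (z + w) = p * s'" by (elim dvdE)
  hence w_eq: "w = x + y - z - p * s'" by simp
  have "p dvd (inv_p x + inv_p y) - (inv_p z + inv_p w)" using i by (simp only: cong_iff_dvd_diff)
  then obtain i' where i': "(inv_p x + inv_p y) - (inv_p z + inv_p w) = p * i'" by (elim dvdE)
  \<comment> \<open>Denominators are cleared by multiplying the relation between the inverses by
    xyzw; X, Y, Z, W record by which multiple of p each product of a number and its inverse differs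
    from 1.\<close>
  have "p dvd (x + y) * (z * w - x * y)"
  proof -
    let ?P = "x * y * z * w"
    have "p * i' * ?P = ((inv_p x + inv_p y) - (inv_p z + inv_p w)) * ?P"
      by (simp only: i')
    also have "\<dots> = (x * inv_p x) * (y * z * w) + (y * inv_p y) * (x * z * w)
        - (z * inv_p z) * (x * y * w) - (w * inv_p w) * (x * y * z)"
      by (simp add: algebra_simps)
    also have "\<dots> = (x + y) * (z * w) - (z + w) * (x * y)
        + p * (X * (y * z * w) + Y * (x * z * w) - Z * (x * y * w) - W * (x * y * z))"
      by (simp only: X Y Z W) (simp add: algebra_simps)
    also have "(z + w) * (x * y) = (x + y) * (x * y) - p * (s' * (x * y))"
      by (simp add: w_eq algebra_simps)
    finally have "(x + y) * (z * w - x * y) = p * (i' * ?P - s' * (x * y)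
        - (X * (y * z * w) + Y * (x * z * w) - Z * (x * y * w) - W * (x * y * z)))"
      by (simp add: algebra_simps)
    thus ?thesis by (rule dvdI)
  qed
  then consider "p dvd x + y" | "p dvd z * w - x * y"
    using prime_p by (auto simp: prime_dvd_mult_iff)
  thus ?thesis
  proof cases
    case 1
    moreover have "p dvd z + w" using 1 s by (simp add: cong_dvd_iff)
    ultimately show ?thesis using comp[OF _ U(1,2)] comp[OF _ U(3,4)] by simp
  next
    case 2
    \<comment> \<open>The quadratic with roots x and y vanishes at z modulo p.\<close>
    have "(z - x) * (z - y) = - (z * w - x * y) - p * (s' * z)"
      by (simp add: w_eq algebra_simps)
    also have "p dvd \<dots>" using 2 by (intro dvd_diff) (simp_all only: dvd_minus_iff dvd_triv_left)
    finally have "p dvd z - x \<or> p dvd z - y" using prime_p by (simp add: prime_dvd_mult_iff)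
    hence "z = x \<or> z = y" using U_eqI U by blast
    thus ?thesis
    proof
      assume z: "z = x"
      hence "y = w" using s_dvd U by (intro U_eqI) simp_all
      thus ?thesis using z by simp
    next
      assume z: "z = y"
      hence "x = w" using s_dvd U by (intro U_eqI) simp_all
      thus ?thesis using z by simp
    qed
  qed
qed

text \<open>|K|^4 is the squared norm of K^2, which is itself an exponential sum, over pairs in
  \<open>U \<times> U\<close>. The factor 3 counts the families of solutions, each of size at most
  (p - 1)^2; overlaps are ignored.\<close>

lemma fourth_moment_kloosterman:
  "(\<Sum>m\<in>R. \<Sum>n\<in>R. cmod (kloosterman m n) ^ 4) \<le> (real_of_int p)\<^sup>2 * (3 * (real_of_int p - 1)\<^sup>2)"
proof -
  let ?u = "\<lambda>q. fst q + snd q" and ?v = "\<lambda>q. inv_p (fst q) + inv_p (snd q)"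
  let ?C = "{(q, q'). q \<in> U \<times> U \<and> q' \<in> U \<times> U \<and> [?u q = ?u q'] (mod p) \<and> [?v q = ?v q'] (mod p)}"
  have "cmod (kloosterman m n) ^ 4 = (cmod (\<Sum>q\<in>U\<times>U. e (m * ?u q + n * ?v q)))\<^sup>2" for m n
  proof -
    have "kloosterman m n ^ 2 = (\<Sum>q\<in>U\<times>U. e (m * ?u q + n * ?v q))"
      by (simp add: kloosterman_def power2_eq_square sum_product sum.cartesian_product case_prod_unfold flip: e_add)
         (simp add: algebra_simps)
    hence "cmod (kloosterman m n ^ 2) = cmod (\<Sum>q\<in>U\<times>U. e (m * ?u q + n * ?v q))"
      by (rule arg_cong)
    hence "(cmod (\<Sum>q\<in>U\<times>U. e (m * ?u q + n * ?v q)))\<^sup>2 = ((cmod (kloosterman m n))\<^sup>2)\<^sup>2"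
      by (simp only: norm_power)
    thus ?thesis by simp
  qed
  hence "(\<Sum>m\<in>R. \<Sum>n\<in>R. cmod (kloosterman m n) ^ 4) = (real_of_int p)\<^sup>2 * real (card ?C)"
    using sum_norm_square_e[of "U \<times> U" ?u ?v] by simp
  also have "\<dots> \<le> (real_of_int p)\<^sup>2 * (3 * (real_of_int p - 1)\<^sup>2)"
  proof (rule mult_left_mono)
    let ?f1 = "\<lambda>(x, y). ((x, y), (x, y))" and ?f2 = "\<lambda>(x, y). ((x, y), (y, x))"
      and ?f3 = "\<lambda>(x, y). ((x, p - x), (y, p - y))"
    have "?C \<subseteq> ?f1 ` (U \<times> U) \<union> ?f2 ` (U \<times> U) \<union> ?f3 ` (U \<times> U)" (is "_ \<subseteq> ?S")
    proof
      fix a assume a_in: "a \<in> ?C"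
      define x y z w where "x = fst (fst a)" "y = snd (fst a)" "z = fst (snd a)" "w = snd (snd a)"
      hence a: "a = ((x, y), (z, w))" by simp
      have U: "x \<in> U" "y \<in> U" "z \<in> U" "w \<in> U"
        and *: "[x + y = z + w] (mod p)" "[inv_p x + inv_p y = inv_p z + inv_p w] (mod p)"
        using a_in unfolding a mem_Collect_eq case_prod_conv mem_Times_iff fst_conv snd_conv by blast+
      consider "a = ?f1 (x, y)" | "a = ?f2 (x, y)" | "a = ?f3 (x, z)"
        using sum_and_inverse_sum_cases[OF U *] a by auto
      thus "a \<in> ?S"
      proof cases
        case 1
        thus ?thesis using U by (intro UnI1 rev_image_eqI[of "(x, y)"]) auto
      next
        case 2
        thus ?thesis using U by (intro UnI1[OF UnI2] rev_image_eqI[of "(x, y)"]) auto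
      next
        case 3
        thus ?thesis using U by (intro UnI2 rev_image_eqI[of "(x, z)"]) auto
      qed
    qed
    hence "card ?C \<le> card ?S"
      by (rule card_mono[rotated]) (intro finite_UnI finite_imageI finite_cartesian_product finite_atLeastLessThan_int)
    also have "\<dots> \<le> card (?f1 ` (U \<times> U)) + card (?f2 ` (U \<times> U)) + card (?f3 ` (U \<times> U))"
      by (intro order_trans[OF card_Un_le] add_mono card_Un_le order_refl)
    also have "\<dots> \<le> card (U \<times> U) + card (U \<times> U) + card (U \<times> U)"
      by (intro add_mono card_image_le) auto
    also have "\<dots> = 3 * (nat (p - 1))\<^sup>2" by (simp add: power2_eq_square)
    finally have "real (card ?C) \<le> real (3 * (nat (p - 1))\<^sup>2)" by (rule of_nat_mono)
    thus "real (card ?C) \<le> 3 * (real_of_int p - 1)\<^sup>2" using p_gt_1 by simp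
  qed simp
  finally show ?thesis .
qed

text \<open>The pairs (a t, b/t) are distinct already in their first coordinate, so p - 1 copies of
  the left-hand side fit into the fourth moment; one factor p - 1 cancels.\<close>

lemma norm_kloosterman_le:
  assumes a: "\<not> p dvd a" and b: "\<not> p dvd b"
  shows "cmod (kloosterman a b) ^ 4 \<le> 3 * real_of_int p ^ 3"
proof -
  let ?g = "\<lambda>t. (a * t mod p, b * inv_p t mod p)"
  have "inj_on (\<lambda>t. a * t mod p) U"
    using a bij_betw_int_remainders_mult[of a p] by (simp add: coprime_iff bij_betw_def)
  hence inj: "inj_on ?g U"
    by (auto simp: inj_on_def)
  have "(real_of_int p - 1) * cmod (kloosterman a b) ^ 4 = (\<Sum>t\<in>U. cmod (kloosterman a b) ^ 4)"
    using p_gt_1 by simp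
  also have "\<dots> = (\<Sum>t\<in>U. (\<lambda>(m, n). cmod (kloosterman m n) ^ 4) (?g t))"
  proof (intro sum.cong refl)
    fix t assume t: "t \<in> U"
    have "kloosterman (a * t mod p) (b * inv_p t mod p) = kloosterman a b"
      using kloosterman_cong[of "a * t mod p" "a * t" "b * inv_p t mod p" "b * inv_p t"] kloosterman_dilate[OF t] by simp
    thus "cmod (kloosterman a b) ^ 4 = (\<lambda>(m, n). cmod (kloosterman m n) ^ 4) (?g t)" by simp
  qed
  also have "\<dots> = (\<Sum>(m,n)\<in>?g ` U. cmod (kloosterman m n) ^ 4)"
    using sum.reindex[OF inj, of "\<lambda>(m, n). cmod (kloosterman m n) ^ 4"] by (simp add: o_def)
  also have "\<dots> \<le> (\<Sum>(m,n)\<in>R \<times> R. cmod (kloosterman m n) ^ 4)"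
    using p_pos by (intro sum_mono2) auto
  also have "\<dots> = (\<Sum>m\<in>R. \<Sum>n\<in>R. cmod (kloosterman m n) ^ 4)"
    by (simp add: sum.cartesian_product)
  also have "\<dots> \<le> (real_of_int p)\<^sup>2 * (3 * (real_of_int p - 1)\<^sup>2)"
    by (rule fourth_moment_kloosterman)
  finally have "(real_of_int p - 1) * cmod (kloosterman a b) ^ 4 \<le> (real_of_int p - 1) * (3 * (real_of_int p)\<^sup>2 * (real_of_int p - 1))"
    by (simp only: power2_eq_square mult_ac)
  hence "cmod (kloosterman a b) ^ 4 \<le> 3 * (real_of_int p)\<^sup>2 * (real_of_int p - 1)"
    using p_gt_1 by (subst (asm) mult_le_cancel_left_pos) auto
  also have "\<dots> \<le> 3 * (real_of_int p)\<^sup>2 * real_of_int p"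
    by (intro mult_left_mono) auto
  finally show ?thesis by (simp add: power3_eq_cube power2_eq_square)
qed

subsection \<open>Correlations of residues and inverses\<close>

text \<open>The discrete Fourier coefficients of the residue function; the factor 1/p is placed
  here, so the inversion formula has none.\<close>

definition saw_coeff :: "int \<Rightarrow> complex" where
  "saw_coeff m = (\<Sum>y\<in>R. of_int y * e (- m * y)) / of_int p"

lemma fourier_inversion: "of_int (x mod p) = (\<Sum>m\<in>R. saw_coeff m * e (m * x))"
proof -
  have "(\<Sum>m\<in>R. saw_coeff m * e (m * x)) = (\<Sum>m\<in>R. \<Sum>y\<in>R. of_int y * e (m * (x - y))) / of_int p"
    by (simp add: saw_coeff_def sum_divide_distrib sum_distrib_right mult.assoc flip: e_add)
       (simp add: algebra_simps)
  also have "(\<Sum>m\<in>R. \<Sum>y\<in>R. of_int y * e (m * (x - y))) = (\<Sum>y\<in>R. of_int y * (\<Sum>m\<in>R. e (m * (x - y))))"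
    by (subst sum.swap) (simp add: sum_distrib_left)
  also have "\<dots> = (\<Sum>y\<in>R. if y = x mod p then of_int y * of_int p else 0)"
  proof (intro sum.cong refl)
    fix y assume "y \<in> R"
    hence "p dvd x - y \<longleftrightarrow> y = x mod p"
      by (auto simp: mod_eq_dvd_iff[symmetric])
    thus "of_int y * (\<Sum>m\<in>R. e (m * (x - y))) = (if y = x mod p then of_int y * of_int p else 0)"
      by (simp add: sum_e)
  qed
  also have "\<dots> = of_int (x mod p) * of_int p"
    using p_pos by simp
  finally show ?thesis using p_pos by simp
qed

lemma sum_of_int_R: "(\<Sum>y\<in>R. of_int y) = (of_int p * (of_int p - 1) / 2 :: 'a :: field_char_0)"
proof -
  have "(\<Sum>k<n. of_nat k) = (of_nat n * (of_nat n - 1) / 2 :: 'a)" for n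
    by (induction n) (simp_all add: field_simps)
  from this[of "nat p"] show ?thesis using p_pos by (simp add: sum_R)
qed

lemma saw_coeff_0: "saw_coeff 0 = of_real ((of_int p - 1) / 2)"
  using p_pos by (simp add: saw_coeff_def sum_of_int_R)

text \<open>For nonzero m the coefficient is exactly 1 / (w - 1) with w = e(-m), and |w - 1| = 2 sin
  (pi m / p). Adding the reciprocals of the distances to both ends of the period avoids a
  distinction between its two halves in the statement.\<close>

lemma norm_saw_coeff:
  assumes "m \<in> U"
  shows "cmod (saw_coeff m) \<le> real_of_int p * (1 / real_of_int m + 1 / (real_of_int p - real_of_int m))"
proof -
  define w where "w = e (- m)"
  have w1: "w \<noteq> 1" using U_not_dvd[OF assms] by (simp add: w_def e_eq_1_iff)
  have wp: "w ^ nat p = 1" using p_pos by (simp add: w_def e_power e_eq_1_iff)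
  have "(w - 1)\<^sup>2 * (\<Sum>y<nat p. of_nat y * w ^ y) = of_int p * (w - 1)"
    using sum_index_power[of w "nat p"] p_pos by (simp add: wp algebra_simps)
  hence "(w - 1) * (\<Sum>y<nat p. of_nat y * w ^ y) = of_int p"
    using w1 by (simp add: power2_eq_square)
  moreover have "(\<Sum>y<nat p. of_nat y * w ^ y) = of_int p * saw_coeff m"
    using p_pos by (simp add: saw_coeff_def sum_R w_def e_power mult_ac)
  ultimately have "(w - 1) * saw_coeff m = 1" using p_pos by simp
  hence "cmod (w - 1) * cmod (saw_coeff m) = 1" by (metis norm_mult norm_one)
  define t where "t = pi * real_of_int m / real_of_int p"
  have "cmod (w - 1) = 2 * \<bar>sin t\<bar>"
    using norm_cis_diff_1[of "2 * pi * real_of_int (- m) / real_of_int p"]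
    by (simp add: w_def e_def t_def)
  have t: "0 < t" "t < pi"
    using assms p_pos by (simp_all add: t_def pos_divide_less_eq)
  have "cmod (saw_coeff m) = 1 / (2 * sin t)"
    using \<open>cmod (w - 1) * cmod (saw_coeff m) = 1\<close> \<open>cmod (w - 1) = 2 * \<bar>sin t\<bar>\<close> t sin_gt_zero[of t]
    by (simp add: field_simps)
  also have "\<dots> \<le> 1 / t + 1 / (pi - t)"
  proof (cases "t \<le> pi / 2")
    case True
    have "1 / (2 * sin t) \<le> 1 / t"
      using half_le_sin[of t] True t by (intro divide_left_mono) auto
    moreover have "0 \<le> 1 / (pi - t)" using t by simp
    ultimately show ?thesis by linarith
  next
    case False
    have "1 / (2 * sin t) \<le> 1 / (pi - t)"
      using half_le_sin[of "pi - t"] False t by (intro divide_left_mono) auto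
    moreover have "0 \<le> 1 / t" using t by simp
    ultimately show ?thesis by linarith
  qed
  also have "\<dots> = real_of_int p * (1 / real_of_int m + 1 / (real_of_int p - real_of_int m)) / pi"
  proof -
    have "pi - t = pi * (real_of_int p - real_of_int m) / real_of_int p"
      using p_pos by (simp add: t_def field_simps)
    hence "1 / (pi - t) = real_of_int p / (real_of_int p - real_of_int m) / pi" by simp
    moreover have "1 / t = real_of_int p / real_of_int m / pi" by (simp add: t_def)
    ultimately show ?thesis by (simp add: add_divide_distrib distrib_left)
  qed
  also have "\<dots> \<le> real_of_int p * (1 / real_of_int m + 1 / (real_of_int p - real_of_int m)) / 1"
    using pi_ge_two assms p_pos by (intro divide_left_mono mult_nonneg_nonneg add_nonneg_nonneg) auto
  finally show ?thesis by simp
qed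

lemma sum_norm_saw_coeff: "(\<Sum>m\<in>U. cmod (saw_coeff m)) \<le> 2 * real_of_int p * (1 + ln (real_of_int p))"
proof -
  have "(\<Sum>m\<in>U. cmod (saw_coeff m)) \<le> (\<Sum>m\<in>U. real_of_int p * (1 / real_of_int m + 1 / (real_of_int p - real_of_int m)))"
    by (intro sum_mono norm_saw_coeff)
  also have "\<dots> = real_of_int p * (\<Sum>m\<in>U. 1 / real_of_int m + 1 / (real_of_int p - real_of_int m))"
    by (simp add: sum_distrib_left)
  also have "(\<Sum>m\<in>U. 1 / real_of_int m + 1 / (real_of_int p - real_of_int m)) =
     (\<Sum>m=1..<nat p. 1 / real m + 1 / (real (nat p) - real m))"
  proof -
    have "U = int ` {1..<nat p}" using p_pos by (simp add: image_int_atLeastLessThan)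
    thus ?thesis using p_pos by (simp add: sum.reindex order.strict_implies_order)
  qed
  also have "\<dots> \<le> 2 * (1 + ln (real (nat p)))" using p_pos by (intro sum_reciprocal_pairs_le) simp
  finally show ?thesis using p_pos by (simp add: mult_left_mono mult_ac)
qed

text \<open>Subtracting the mean removes the frequency 0, so that every remaining pair of
  frequencies falls under the Kloosterman bound.\<close>

definition saw :: "int \<Rightarrow> real" where
  "saw x = real_of_int (x mod p) - (real_of_int p - 1) / 2"

lemma saw_cong: "[x = y] (mod p) \<Longrightarrow> saw x = saw y"
  by (simp add: saw_def Cong.cong_def)

lemma saw_bound: "\<bar>saw x\<bar> \<le> real_of_int p / 2"
proof -
  have "0 \<le> x mod p" "x mod p \<le> p - 1" using p_pos by (auto simp: zle_diff1_eq)
  hence "0 \<le> real_of_int (x mod p)" "real_of_int (x mod p) \<le> real_of_int p - 1"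
    using of_int_le_iff[of "x mod p" "p - 1", where 'a = real] by simp_all
  thus ?thesis by (simp add: saw_def abs_le_iff field_simps)
qed

lemma saw_mult_bound: "\<bar>saw x * saw y\<bar> \<le> (real_of_int p)\<^sup>2 / 4"
  using mult_mono[OF saw_bound[of x] saw_bound[of y]] p_pos
  by (simp add: abs_mult power2_eq_square)

lemma saw_fourier: "complex_of_real (saw x) = (\<Sum>m\<in>U. saw_coeff m * e (m * x))"
  using fourier_inversion[of x] by (simp add: saw_def sum_R_split saw_coeff_0)

text \<open>The square of the bound for the absolute sum of the coefficients, times the bound for
  one Kloosterman sum.\<close>

definition corr_bound :: real where
  "corr_bound = (2 * real_of_int p * (1 + ln (real_of_int p)))\<^sup>2 * (3 * real_of_int p ^ 3) powr (1/4)"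

text \<open>The dilations replace the frequencies m, n by a m, c n, still nonzero modulo p; the
  shifts contribute only e(m b + n d), of modulus 1. Hence the bound is uniform in all four
  parameters.\<close>

lemma saw_correlation:
  assumes a: "\<not> p dvd a" and c: "\<not> p dvd c"
  shows "\<bar>\<Sum>x\<in>U. saw (a * x + b) * saw (c * inv_p x + d)\<bar> \<le> corr_bound"
proof -
  let ?B = "(3 * real_of_int p ^ 3) powr (1/4)"
  have dvd: "\<not> p dvd a * m" "\<not> p dvd c * m" if "m \<in> U" for m
    using U_not_dvd[OF that] a c prime_p by (auto simp: prime_dvd_mult_iff)
  have kl_le: "cmod (kloosterman x y) \<le> ?B" if "\<not> p dvd x" "\<not> p dvd y" for x y
  proof -
    have "cmod (kloosterman x y) = (cmod (kloosterman x y) ^ 4) powr (1/4)"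
      by (cases "kloosterman x y = 0") (simp_all add: powr_powr flip: powr_numeral)
    also have "\<dots> \<le> ?B"
      using norm_kloosterman_le[OF that] by (intro powr_mono2) auto
    finally show ?thesis .
  qed
  have "complex_of_real (\<Sum>x\<in>U. saw (a * x + b) * saw (c * inv_p x + d)) =
        (\<Sum>x\<in>U. \<Sum>m\<in>U. \<Sum>n\<in>U. (saw_coeff m * e (m * (a * x + b))) * (saw_coeff n * e (n * (c * inv_p x + d))))"
    by (simp add: saw_fourier sum_product)
  also have "\<dots> = (\<Sum>m\<in>U. \<Sum>n\<in>U. \<Sum>x\<in>U. (saw_coeff m * e (m * (a * x + b))) * (saw_coeff n * e (n * (c * inv_p x + d))))"
  proof -
    have "(\<Sum>x\<in>U. \<Sum>m\<in>U. \<Sum>n\<in>U. F x m n) = (\<Sum>m\<in>U. \<Sum>n\<in>U. \<Sum>x\<in>U. F x m n)"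
      for F :: "int \<Rightarrow> int \<Rightarrow> int \<Rightarrow> complex"
    proof -
      have "(\<Sum>x\<in>U. \<Sum>m\<in>U. \<Sum>n\<in>U. F x m n) = (\<Sum>m\<in>U. \<Sum>x\<in>U. \<Sum>n\<in>U. F x m n)"
        by (rule sum.swap)
      also have "\<dots> = (\<Sum>m\<in>U. \<Sum>n\<in>U. \<Sum>x\<in>U. F x m n)" by (intro sum.cong refl sum.swap)
      finally show ?thesis .
    qed
    thus ?thesis .
  qed
  also have "\<dots> = (\<Sum>m\<in>U. \<Sum>n\<in>U. saw_coeff m * saw_coeff n * e (m * b + n * d) * kloosterman (a * m) (c * n))"
  proof (intro sum.cong refl)
    fix m n
    have "e (m * (a * x + b)) * e (n * (c * inv_p x + d)) = e (m * b + n * d) * e (a * m * x + c * n * inv_p x)" for x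
      by (simp flip: e_add) (simp add: algebra_simps)
    thus "(\<Sum>x\<in>U. (saw_coeff m * e (m * (a * x + b))) * (saw_coeff n * e (n * (c * inv_p x + d)))) =
          saw_coeff m * saw_coeff n * e (m * b + n * d) * kloosterman (a * m) (c * n)"
      unfolding kloosterman_def sum_distrib_left
      by (intro sum.cong refl) (simp only: mult.assoc mult.left_commute[of "e _" "saw_coeff _"])
  qed
  finally have eq: "complex_of_real (\<Sum>x\<in>U. saw (a * x + b) * saw (c * inv_p x + d)) =
      (\<Sum>m\<in>U. \<Sum>n\<in>U. saw_coeff m * saw_coeff n * e (m * b + n * d) * kloosterman (a * m) (c * n))" .
  have "\<bar>\<Sum>x\<in>U. saw (a * x + b) * saw (c * inv_p x + d)\<bar> =
      cmod (\<Sum>m\<in>U. \<Sum>n\<in>U. saw_coeff m * saw_coeff n * e (m * b + n * d) * kloosterman (a * m) (c * n))"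
    by (simp only: norm_of_real flip: eq)
  also have "\<dots> \<le> (\<Sum>m\<in>U. \<Sum>n\<in>U. cmod (saw_coeff m) * cmod (saw_coeff n) * ?B)"
    by (intro sum_norm_le) (simp add: norm_mult mult_left_mono kl_le dvd)
  also have "\<dots> = (\<Sum>m\<in>U. cmod (saw_coeff m))\<^sup>2 * ?B"
    by (simp only: power2_eq_square sum_product) (simp only: sum_distrib_right)
  also have "\<dots> \<le> corr_bound"
    unfolding corr_bound_def by (intro mult_right_mono power_mono sum_norm_saw_coeff sum_nonneg) auto
  finally show ?thesis .
qed

section \<open>From the centred sawtooth to residues and inverses\<close>

lemma bij_betw_affine:
  assumes "\<not> p dvd a"
  shows "bij_betw (\<lambda>x. (a * x + b) mod p) R R"
proof -
  have "inj_on (\<lambda>x. (a * x + b) mod p) R"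
  proof (rule inj_onI)
    fix x y assume xy: "x \<in> R" "y \<in> R" "(a * x + b) mod p = (a * y + b) mod p"
    have "p dvd a * (x - y)" using xy(3) by (simp add: mod_eq_dvd_iff algebra_simps)
    hence "p dvd x - y" using assms prime_p by (simp add: prime_dvd_mult_iff)
    thus "x = y" using xy(1,2) by (simp add: mod_eq_dvd_iff[symmetric])
  qed
  moreover have "(\<lambda>x. (a * x + b) mod p) ` R \<subseteq> R" using p_pos by auto
  ultimately show ?thesis
    by (simp add: bij_betw_def endo_inj_surj)
qed

lemma sum_affine:
  assumes "\<not> p dvd a" "\<And>x y. [x = y] (mod p) \<Longrightarrow> f x = f y"
  shows "(\<Sum>x\<in>R. f (a * x + b)) = (\<Sum>x\<in>R. f x)"
proof -
  have "(\<Sum>x\<in>R. f (a * x + b)) = (\<Sum>x\<in>R. f ((a * x + b) mod p))"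
    by (intro sum.cong refl assms) (simp add: Cong.cong_def)
  also have "\<dots> = (\<Sum>x\<in>R. f x)"
    by (rule sum.reindex_bij_betw[OF bij_betw_affine[OF assms(1)]])
  finally show ?thesis .
qed

lemma sum_inv: "(\<Sum>x\<in>R. f (inv_p x)) = (\<Sum>x\<in>R. f x)"
  by (rule sum.reindex_bij_witness[where i = inv_p and j = inv_p]) (use inv_in_R in \<open>auto simp: inv_inv\<close>)

lemma sum_saw: "(\<Sum>x\<in>R. saw x) = 0"
  using p_pos by (simp add: saw_def sum_subtractf sum_of_int_R)

text \<open>With both factors centred the cross terms vanish, and the squared mean ((p - 1)/2)^2,
  summed over p residues, is the main term.\<close>

lemma sum_mod_products:
  assumes "(\<Sum>x\<in>R. saw (f x)) = 0" "(\<Sum>x\<in>R. saw (g x)) = 0"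
  shows "(\<Sum>x\<in>R. real_of_int (f x mod p) * real_of_int (g x mod p)) =
         (\<Sum>x\<in>R. saw (f x) * saw (g x)) + real_of_int p * (real_of_int p - 1)\<^sup>2 / 4"
proof -
  let ?c = "(real_of_int p - 1) / 2"
  have "(\<Sum>x\<in>R. real_of_int (f x mod p) * real_of_int (g x mod p)) = (\<Sum>x\<in>R. (saw (f x) + ?c) * (saw (g x) + ?c))"
    by (simp add: saw_def)
  also have "\<dots> = (\<Sum>x\<in>R. saw (f x) * saw (g x)) + ?c * (\<Sum>x\<in>R. saw (f x)) + ?c * (\<Sum>x\<in>R. saw (g x)) + (\<Sum>x\<in>R. ?c * ?c)"
    by (simp only: sum.distrib[symmetric] sum_distrib_left) (simp only: algebra_simps)
  finally show ?thesis using assms p_pos by (simp add: power2_eq_square)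
qed

lemma shift_inv_correlation:
  "\<bar>(\<Sum>x\<in>R. real_of_int ((x + t) mod p) * real_of_int (inv_p x)) - real_of_int p * (real_of_int p - 1)\<^sup>2 / 4\<bar>
     \<le> corr_bound + (real_of_int p)\<^sup>2"
proof -
  have p1: "\<not> p dvd 1" using p_gt_1 by auto
  have "(\<Sum>x\<in>R. saw (x + t)) = 0"
    using sum_affine[of 1 saw t] saw_cong p1 sum_saw by simp
  moreover have "(\<Sum>x\<in>R. saw (inv_p x)) = 0"
    using sum_inv[of saw] sum_saw by simp
  ultimately have "(\<Sum>x\<in>R. real_of_int ((x + t) mod p) * real_of_int (inv_p x mod p)) =
    (\<Sum>x\<in>R. saw (x + t) * saw (inv_p x)) + real_of_int p * (real_of_int p - 1)\<^sup>2 / 4"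
    by (rule sum_mod_products)
  moreover have "inv_p x mod p = inv_p x" for x using inv_in_R[of x] by simp
  moreover have "\<bar>\<Sum>x\<in>R. saw (x + t) * saw (inv_p x)\<bar> \<le> corr_bound + (real_of_int p)\<^sup>2"
  proof -
    \<comment> \<open>The residue 0 lies outside the Kloosterman range; its single term is at most
      p^2/4 and goes into the error.\<close>
    have "\<bar>\<Sum>x\<in>R. saw (x + t) * saw (inv_p x)\<bar> \<le> \<bar>saw (0 + t) * saw (inv_p 0)\<bar> + \<bar>\<Sum>x\<in>U. saw (x + t) * saw (inv_p x)\<bar>"
      by (simp only: sum_R_split abs_triangle_ineq)
    also have "\<dots> \<le> (real_of_int p)\<^sup>2 + corr_bound"
    proof (rule add_mono)
      have "(real_of_int p)\<^sup>2 / 4 \<le> (real_of_int p)\<^sup>2" by simp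
      with saw_mult_bound show "\<bar>saw (0 + t) * saw (inv_p 0)\<bar> \<le> (real_of_int p)\<^sup>2"
        by (rule order_trans)
      show "\<bar>\<Sum>x\<in>U. saw (x + t) * saw (inv_p x)\<bar> \<le> corr_bound"
        using saw_correlation[of 1 1 t 0] p1 by simp
    qed
    finally show ?thesis by simp
  qed
  ultimately show ?thesis by simp
qed

lemma inv_inv_correlation:
  assumes h: "\<not> p dvd h"
  shows "\<bar>(\<Sum>x\<in>R. real_of_int (inv_p x) * real_of_int (inv_p (x + h))) - real_of_int p * (real_of_int p - 1)\<^sup>2 / 4\<bar>
     \<le> corr_bound + (real_of_int p)\<^sup>2"
proof -
  have p1: "\<not> p dvd 1" using p_gt_1 by auto
  define g where "g = inv_p h"
  have g: "\<not> p dvd g" using inv_in_U[OF h] U_not_dvd g_def by blast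
  have hg: "[h * g = 1] (mod p)" using inv_cong1[OF h] by (simp add: g_def)
  have c: "saw (inv_p x) = saw (inv_p y)" if "[x = y] (mod p)" for x y
    using inv_cong[OF that] by simp
  have "(\<Sum>x\<in>R. saw (inv_p x)) = 0"
    using sum_inv[of saw] sum_saw by simp
  moreover have "(\<Sum>x\<in>R. saw (inv_p (x + h))) = 0"
    using sum_affine[of 1 "\<lambda>x. saw (inv_p x)" h] c p1 calculation by simp
  ultimately have "(\<Sum>x\<in>R. real_of_int (inv_p x mod p) * real_of_int (inv_p (x + h) mod p)) =
    (\<Sum>x\<in>R. saw (inv_p x) * saw (inv_p (x + h))) + real_of_int p * (real_of_int p - 1)\<^sup>2 / 4"
    by (rule sum_mod_products)
  moreover have "inv_p x mod p = inv_p x" for x using inv_in_R[of x] by simp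
  moreover have "\<bar>\<Sum>x\<in>R. saw (inv_p x) * saw (inv_p (x + h))\<bar> \<le> corr_bound + (real_of_int p)\<^sup>2"
  proof -
    \<comment> \<open>With \<open>x = 1/y\<close> and then \<open>y = (z - 1)/h\<close> one gets \<open>1/(x + h) = (1 - 1/z)/h\<close>,
      for all \<open>z\<close> other than \<open>0\<close> and \<open>1\<close>.\<close>
    let ?H = "\<lambda>y. saw y * saw (inv_p (inv_p y + h))"
    let ?G = "\<lambda>z. saw (g * z + (- g)) * saw ((- g) * inv_p z + g)"
    have "(\<Sum>x\<in>R. saw (inv_p x) * saw (inv_p (x + h))) = (\<Sum>y\<in>R. saw (inv_p (inv_p y)) * saw (inv_p (inv_p y + h)))"
      by (rule sum_inv[symmetric])
    also have "\<dots> = (\<Sum>y\<in>R. ?H y)"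
      by (intro sum.cong) (auto simp: inv_inv)
    also have "\<dots> = (\<Sum>z\<in>R. ?H (g * z + (- g)))"
      by (rule sum_affine[symmetric])
         (use g in \<open>auto intro!: arg_cong2[of _ _ _ _ "(*)"] saw_cong inv_cong cong_add simp: inv_cong\<close>)
    \<comment> \<open>The values z = 0 and z = 1 come from x = -h and x = 0. At z = 1 the true term
      is exchanged for that of \<open>?G\<close>, which completes the sum over \<open>U\<close>; the
      three stray terms together are at most 3 p^2 / 4.\<close>
    also have "\<dots> = ?H (g * 0 + (- g)) + (?H (g * 1 + (- g)) - ?G 1) + (\<Sum>z\<in>U. ?G z)"
    proof -
      have eq: "?H (g * z + (- g)) = ?G z" if z: "z \<in> U - {1}" for z
      proof -
        let ?y = "g * z + (- g)"
        have z': "\<not> p dvd z" "\<not> p dvd z - 1" using z by (auto simp: zdvd_not_zless)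
        have y: "\<not> p dvd ?y" using g z' prime_p prime_dvd_mult_iff[of p g "z - 1"] by (simp add: algebra_simps)
        have iz: "[z * inv_p z = 1] (mod p)" "[?y * inv_p ?y = 1] (mod p)" using z' y inv_cong1 by blast+
        \<comment> \<open>Checked after multiplication by z, which is cancelled at the end; A, B, C
          are the multiples of p in the three inverse relations.\<close>
        have "[(inv_p ?y + h) * ((- g) * inv_p z + g) = 1] (mod p)"
        proof -
          obtain A B C where A: "z * inv_p z = 1 + p * A" "?y * inv_p ?y = 1 + p * B" "h * g = 1 + p * C"
            using iz hg by (metis cong_iff_lin cong_sym)
          have "p dvd z * ((inv_p ?y + h) * ((- g) * inv_p z + g) - 1)"
          proof -
            have "z * ((inv_p ?y + h) * ((- g) * inv_p z + g) - 1)
               = (inv_p ?y + h) * (g * z - g * (z * inv_p z)) - z" by (simp add: algebra_simps)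
            also have "\<dots> = (inv_p ?y + h) * (?y - g * p * A) - z" by (simp add: A algebra_simps)
            also have "\<dots> = ?y * inv_p ?y + (h * g) * (z - 1) - (inv_p ?y + h) * g * p * A - z" by (simp add: algebra_simps)
            also have "\<dots> = p * (B + C * (z - 1) - (inv_p ?y + h) * g * A)" by (simp only: A(2,3)) (simp add: algebra_simps)
            finally show ?thesis by simp
          qed
          thus ?thesis using z' prime_p by (simp add: prime_dvd_mult_iff cong_iff_dvd_diff)
        qed
        hence "inv_p (inv_p ?y + h) = ((- g) * inv_p z + g) mod p" by (rule inv_eqI)
        thus ?thesis using saw_cong[of "((- g) * inv_p z + g) mod p" "(- g) * inv_p z + g"] by simp
      qed
      have "U = insert 1 (U - {1})" using p_gt_1 by auto
      hence split: "(\<Sum>z\<in>U. F z) = F 1 + (\<Sum>z\<in>U - {1}. F z)" for F :: "int \<Rightarrow> real"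
        by (metis finite_Diff finite_atLeastLessThan_int insert_Diff_single sum.insert_remove)
      have "(\<Sum>z\<in>U - {1}. ?H (g * z + (- g))) = (\<Sum>z\<in>U - {1}. ?G z)"
        by (intro sum.cong refl eq)
      thus ?thesis unfolding sum_R_split split[of ?G] split[of "\<lambda>z. ?H (g * z + (- g))"] by linarith
    qed
    finally have "\<bar>\<Sum>x\<in>R. saw (inv_p x) * saw (inv_p (x + h))\<bar> \<le>
       \<bar>?H (g * 0 + (- g))\<bar> + \<bar>?H (g * 1 + (- g))\<bar> + \<bar>?G 1\<bar> + \<bar>\<Sum>z\<in>U. ?G z\<bar>" by linarith
    moreover have "\<bar>?H y\<bar> \<le> (real_of_int p)\<^sup>2 / 4" for y by (rule saw_mult_bound)
    moreover have "\<bar>?G 1\<bar> \<le> (real_of_int p)\<^sup>2 / 4" by (rule saw_mult_bound)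
    moreover have "\<bar>\<Sum>z\<in>U. ?G z\<bar> \<le> corr_bound" using g by (intro saw_correlation) auto
    ultimately show ?thesis
      using \<open>\<And>y. \<bar>?H y\<bar> \<le> _\<close>[of "g * 0 + (- g)"] \<open>\<And>y. \<bar>?H y\<bar> \<le> _\<close>[of "g * 1 + (- g)"] zero_le_power2[of "real_of_int p"] by linarith
  qed
  ultimately show ?thesis by simp
qed

subsection \<open>Common divisors of differences\<close>

lemma inv_p_eqI: "0 \<le> y \<Longrightarrow> y < p \<Longrightarrow> p dvd x * y - 1 \<Longrightarrow> inv_p x = y"
  using inv_eqI[of x y] by (simp add: cong_iff_dvd_diff)

lemma mod_in_U: "\<not> p dvd a \<Longrightarrow> a mod p \<in> U"
  using pos_mod_bound[OF p_pos, of a] pos_mod_sign[OF p_pos, of a] unfolding dvd_eq_mod_eq_0 atLeastLessThan_iff by linarith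

text \<open>With b = t mod p the two numbers are b and b - p, so D divides p and b, which are
  coprime. The places 0 and p - 1 are fixed by inversion, so the criterion compares a shift with the
  residues as well as with the inverses.\<close>

lemma no_common_divisor_wrap:
  assumes t: "\<not> p dvd t" and D: "D dvd t mod p" "D dvd (p - 1 + t) mod p - (p - 1)"
  shows "D dvd 1"
proof -
  define b where "b = t mod p"
  have b: "0 < b" "b < p"
    using mod_in_U[of t] t by (simp_all add: b_def)
  have "p dvd (p - 1 + t) - (b - 1)"
    by (simp add: b_def minus_mod_eq_mult_div)
  hence "(p - 1 + t) mod p = (b - 1) mod p" by (simp add: mod_eq_dvd_iff)
  hence "(p - 1 + t) mod p = b - 1" using b by simp
  hence bp: "D dvd b - p" using D(2) by simp
  have "D dvd b" using D(1) by (simp add: b_def)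
  from this bp have "D dvd b - (b - p)" by (rule dvd_diff)
  hence "D dvd p" by simp
  moreover have "coprime b p" using b zdvd_not_zless by (auto simp: coprime_iff)
  ultimately show ?thesis using \<open>D dvd b\<close> coprime_common_divisor by blast
qed

lemma no_common_divisor_shift:
  assumes t: "\<not> p dvd t" and D: "\<And>x. D dvd (x + t) mod p - x mod p"
  shows "D dvd 1"
proof (rule no_common_divisor_wrap[OF t])
  show "D dvd t mod p" using D[of 0] by simp
  have "(p - 1) mod p = p - 1" using p_gt_1 by (intro mod_pos_pos_trivial) auto
  thus "D dvd (p - 1 + t) mod p - (p - 1)" using D[of "p - 1"] by (simp only:)
qed

text \<open>If the shift is nonzero modulo p, the wrap-around decides. For aligned points it gives
  nothing, since 0 and p - 1 are their own inverses, and explicit inverses are compared. The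
  threshold makes 12 a residue below p and excludes p = 7, where 2 divides every difference.\<close>

lemma no_common_divisor_shift_inv:
  assumes p: "13 \<le> p" and D: "\<And>x. D dvd (x + a) mod p - inv_p x"
  shows "D dvd 1"
proof (cases "p dvd a")
  case False
  have "inv_p (p - 1) = p - 1"
    using p_gt_1 by (intro inv_p_eqI) (simp_all add: algebra_simps)
  hence "D dvd (p - 1 + a) mod p - (p - 1)" using D[of "p - 1"] by (simp only:)
  moreover have "D dvd a mod p" using D[of 0] by (simp add: inv_of_multiple)
  ultimately show ?thesis using no_common_divisor_wrap[OF False] by blast
next
  case True
  have D': "D dvd x - inv_p x" if "0 \<le> x" "x < p" for x
    proof -
    have "(x + a) mod p = x mod p" using True by (simp add: mod_eq_dvd_iff)
    thus ?thesis using D[of x] that by simp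
  qed
  \<comment> \<open>Multiplying the difference x - y by x eliminates the inverse y.\<close>
  have D_mult: "D dvd x * x - p * c - 1" if "0 \<le> x" "x < p" "x * y = p * c + 1" "0 \<le> y" "y < p" for x y c
  proof -
    have "inv_p x = y" using that by (intro inv_p_eqI) auto
    hence "D dvd x * (x - y)" using D'[of x] that by simp
    thus ?thesis using that(3) by (simp add: right_diff_distrib diff_diff_eq)
  qed
  have odd: "p mod 2 = 1"
    using prime_p p prime_odd_int[of p] by presburger
  \<comment> \<open>The inverse of 2 gives p = 3 modulo D, which turns the later conditions into
    conditions on fixed numbers.\<close>
  have D3: "D dvd p - 3"
  proof -
    have "D dvd 2 * 2 - p * 1 - 1" by (rule D_mult[of 2 "(p + 1) div 2" 1]) (use odd p in presburger)+
    thus ?thesis using dvd_minus_iff[of D "p - 3"] by simp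
  qed
  have "p mod 3 = 1 \<or> p mod 3 = 2"
  proof -
    have "\<not> 3 dvd p" using prime_p p using primes_dvd_imp_eq[of 3 p] by auto
    thus ?thesis by presburger
  qed
  thus ?thesis
  proof
    \<comment> \<open>Here 3 yields D | 5, while 4 yields D | 12 or D | 6; then 25 - 24 = 1
      finishes.\<close>
    assume m3: "p mod 3 = 2"
    have "D dvd 3 * 3 - p * 1 - 1" by (rule D_mult[of 3 "(p + 1) div 3" 1]) (use m3 p in presburger)+
    hence "D dvd (3 * 3 - p * 1 - 1) + (p - 3)" using D3 by (rule dvd_add)
    hence D5: "D dvd 5" by simp
    have "p mod 4 = 1 \<or> p mod 4 = 3" using odd by presburger
    hence "D dvd 6 * 2"
    proof
      assume "p mod 4 = 3"
      hence "D dvd 4 * 4 - p * 1 - 1" using p by (intro D_mult[of 4 "(p + 1) div 4" 1]) presburger+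
      hence "D dvd (4 * 4 - p * 1 - 1) + (p - 3)" using D3 by (rule dvd_add)
      thus ?thesis by simp
    next
      assume "p mod 4 = 1"
      hence "D dvd 4 * 4 - p * 3 - 1" using p by (intro D_mult[of 4 "(3 * p + 1) div 4" 3]) presburger+
      hence "D dvd (4 * 4 - p * 3 - 1) + (p - 3) * 3" using D3 by (intro dvd_add dvd_mult2)
      hence "D dvd 6" by simp
      thus ?thesis by (rule dvd_mult2)
    qed
    hence "D dvd 5 * 5 - 2 * (6 * 2)" using D5 by (rule dvd_diff[OF dvd_mult dvd_mult, rotated])
    thus ?thesis by simp
  next
    \<comment> \<open>Here 3 yields only D | 2, so the prime 2 has to be excluded
      separately.\<close>
    assume m3: "p mod 3 = 1"
    have "D dvd 3 * 3 - p * 2 - 1" by (rule D_mult[of 3 "(2 * p + 1) div 3" 2]) (use m3 p in presburger)+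
    hence "D dvd (3 * 3 - p * 2 - 1) + (p - 3) * 2" using D3 by (intro dvd_add dvd_mult2)
    hence D2: "D dvd 2" by simp
    show ?thesis
    proof (rule ccontr)
      assume "\<not> D dvd 1"
      have "\<bar>D\<bar> \<le> 2" using D2 by (intro zdvd_imp_le[of "\<bar>D\<bar>" 2]) auto
      moreover have "\<bar>D\<bar> \<noteq> 0" using D2 by auto
      moreover have "\<bar>D\<bar> \<noteq> 1" using \<open>\<not> D dvd 1\<close> by auto
      ultimately have "2 dvd D" by presburger
      have parity: "even x \<longleftrightarrow> even y" if "0 \<le> x" "x < p" "x * y = p * c + 1" "0 \<le> y" "y < p" for x y c
      proof -
        have "inv_p x = y" using that by (intro inv_p_eqI) auto
        hence "D dvd x - y" using D' that by blast
        hence "2 dvd x - y" using \<open>2 dvd D\<close> by (rule dvd_trans[rotated])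
        thus ?thesis by presburger
      qed
      \<comment> \<open>Inversion now preserves parity, so \<open>p + 1\<close> has no factorization into an odd and an even
        number below \<open>p\<close>, which makes \<open>p\<close> a Mersenne prime; but then \<open>5 * p + 1\<close> is
        \<open>12\<close> times an odd number.\<close>
      define k where "k = multiplicity 2 (p + 1)"
      obtain m where m: "p + 1 = 2 ^ k * m" "\<not> 2 dvd m"
        using multiplicity_decompose'[of "p + 1" "2 :: int"] p unfolding k_def by auto
      have "m > 0" using m(1) p by (smt (verit) zero_less_mult_pos zero_less_power)
      have "k > 0"
      proof (rule ccontr)
        assume "\<not> k > 0"
        hence "p + 1 = m" using m(1) by simp
        thus False using m(2) odd by presburger
      qed
      have "m = 1"
      proof (rule ccontr)
        assume "m \<noteq> 1"
        hence "m \<ge> 2" using \<open>m > 0\<close> by simp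
        have k2: "(2::int) ^ k \<ge> 2" using \<open>k > 0\<close> self_le_power[of "2::int" k] by simp
        have "2 ^ k * 2 \<le> 2 ^ k * m" using \<open>m \<ge> 2\<close> by (intro mult_left_mono) auto
        moreover have "2 * m \<le> 2 ^ k * m" using k2 \<open>m > 0\<close> by (intro mult_right_mono) auto
        ultimately have "2 ^ k < p" "m < p" using m(1) p by linarith+
        hence "even ((2::int) ^ k) \<longleftrightarrow> even m"
          using m(1) \<open>m > 0\<close> by (intro parity[of _ _ 1]) auto
        thus False using m(2) \<open>k > 0\<close> by simp
      qed
      hence pk: "p + 1 = 2 ^ k" using m by simp
      have "k \<ge> 3"
      proof (rule ccontr)
        assume "\<not> k \<ge> 3"
        hence "(2::int) ^ k \<le> 2 ^ 2" by (intro power_increasing) auto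
        thus False using pk p by simp
      qed
      hence "(2::int) ^ 3 dvd 2 ^ k" by (rule le_imp_power_dvd)
      hence "8 dvd p + 1" using pk by simp
      then obtain i where "p + 1 = 8 * i" by (elim dvdE)
      hence i: "p = 8 * i - 1" by simp
      have "(8 * i - 1) mod 3 = 1" using m3 by (simp only: i)
      hence "i mod 3 = 1" by presburger
      hence "i = 3 * (i div 3) + 1" using mult_div_mod_eq[of 3 i] by simp
      then obtain q where "i = 3 * q + 1" by blast
      hence q: "p = 24 * q + 7" using i by simp
      have "even (12 :: int) \<longleftrightarrow> even (10 * q + 3)"
      proof (rule parity[of 12 "10 * q + 3" 5])
        show "12 * (10 * q + 3) = p * 5 + 1" unfolding q by simp
      qed (use q p in linarith)+
      thus False by simp
    qed
  qed
qed

text \<open>The differences telescope along 0, t, 2t, ..., and inversion fixes 0, so D divides the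
  inverse of every multiple of t; the multiple congruent to 1 has inverse 1.\<close>

lemma no_common_divisor_inv_inv:
  assumes t: "\<not> p dvd t" and D: "\<And>x. D dvd inv_p (x + t) - inv_p x"
  shows "D dvd 1"
proof -
  have "D dvd inv_p (int m * t) - inv_p 0" for m
  proof (induction m)
    case (Suc m)
    have "D dvd (inv_p (int m * t + t) - inv_p (int m * t)) + (inv_p (int m * t) - inv_p 0)"
      using D Suc by (rule dvd_add)
    thus ?case by (simp add: algebra_simps)
  qed simp
  from this[of "nat (inv_p t)"] have "D dvd inv_p (inv_p t * t)"
    using inv_in_R[of t] by (simp add: inv_of_multiple)
  moreover have "inv_p (inv_p t * t) = 1"
    using inv_cong[of "inv_p t * t" 1] inv_cong1[OF t] p_gt_1 by (simp add: mult.commute)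
  ultimately show ?thesis by simp
qed

end

subsection \<open>Norms, distances and angles\<close>

lemma bij_betw_shift_mod:
  fixes n h :: nat
  assumes "n > 0"
  shows "bij_betw (\<lambda>j. (h + j) mod n) {..<n} {..<n}"
proof -
  have "inj_on (\<lambda>j. (h + j) mod n) {..<n}"
  proof (rule inj_onI)
    fix x y assume xy: "x \<in> {..<n}" "y \<in> {..<n}" "(h + x) mod n = (h + y) mod n"
    hence "[h + x = h + y] (mod n)" by (simp add: Cong.cong_def)
    hence "[x = y] (mod n)" by (simp add: cong_add_lcancel_nat)
    thus "x = y" using xy(1,2) by (simp add: Cong.cong_def)
  qed
  moreover have "(\<lambda>j. (h + j) mod n) ` {..<n} \<subseteq> {..<n}" using assms by auto
  ultimately show ?thesis by (simp add: bij_betw_def endo_inj_surj)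
qed

lemma sum_shift_mod:
  fixes n h :: nat
  assumes "n > 0"
  shows "(\<Sum>j<n. f ((h + j) mod n)) = (\<Sum>j<n. f j)"
  by (rule sum.reindex_bij_betw[OF bij_betw_shift_mod[OF assms]])

lemma shift_mod_surj:
  fixes n h r :: nat
  assumes "r < n"
  obtains j where "j < n" "(h + j) mod n = r"
proof -
  have "r \<in> (\<lambda>j. (h + j) mod n) ` {..<n}"
    using bij_betw_imp_surj_on[OF bij_betw_shift_mod[of n h]] assms by simp
  thus ?thesis using that by blast
qed

lemma inv_point_carrier [simp]: "inv_point p h \<in> carrier_vec p"
  by (simp add: inv_point_def)

lemma circ_point_carrier [simp]: "circ_point d h \<in> carrier_vec (Suc d)"
  by (simp add: circ_point_def)

lemma circ_point_index: "j < Suc d \<Longrightarrow> circ_point d h $ j = int ((h + j) mod Suc d)"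
  by (simp add: circ_point_def)

lemma inv_point_index: "j < p \<Longrightarrow> inv_point p h $ j = modular_inverse (int p) (int (h + j))"
  by (simp add: inv_point_def)

lemma scalar_prod_eq_sum: "w \<in> carrier_vec n \<Longrightarrow> v \<bullet> w = (\<Sum>j<n. v $ j * w $ j)"
  by (simp add: scalar_prod_def atLeast0LessThan)

section \<open>The common norm; distances and sines from scalar products\<close>

definition sum_squares :: "nat \<Rightarrow> int" where
  "sum_squares n = (\<Sum>k<n. (int k)\<^sup>2)"

lemma real_sum_squares: "real_of_int (sum_squares n) = real n * (real n - 1) * (2 * real n - 1) / 6"
proof -
  have "real_of_int (\<Sum>k<n. (int k)\<^sup>2) = real n * (real n - 1) * (2 * real n - 1) / 6"
    by (induction n) (simp_all add: field_simps power2_eq_square)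
  thus ?thesis by (simp add: sum_squares_def)
qed

lemma circ_point_self_prod: "circ_point d h \<bullet> circ_point d h = sum_squares (Suc d)"
proof -
  have "circ_point d h \<bullet> circ_point d h = (\<Sum>j<Suc d. (int ((h + j) mod Suc d))\<^sup>2)"
    unfolding scalar_prod_eq_sum[OF circ_point_carrier]
    by (intro sum.cong) (simp_all add: circ_point_index power2_eq_square del: of_nat_mod)
  also have "\<dots> = sum_squares (Suc d)"
    unfolding sum_squares_def by (rule sum_shift_mod) simp
  finally show ?thesis .
qed

lemma euclid_norm_eq: "euclid_norm v = sqrt (real_of_int (v \<bullet> v))"
  by (simp add: euclid_norm_def L2_set_def scalar_prod_def atLeast0LessThan power2_eq_square)

lemma euclid_norm_diff:
  assumes "v \<in> carrier_vec n" "w \<in> carrier_vec n"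
  shows "euclid_norm (v - w) = sqrt (real_of_int (v \<bullet> v + w \<bullet> w - 2 * (v \<bullet> w)))"
proof -
  have "(v - w) \<bullet> (v - w) = (\<Sum>j<n. v $ j * v $ j + w $ j * w $ j - 2 * (v $ j * w $ j))"
    unfolding scalar_prod_eq_sum[OF minus_carrier_vec[OF assms]]
    using assms by (intro sum.cong refl) (simp add: algebra_simps)
  also have "\<dots> = v \<bullet> v + w \<bullet> w - 2 * (v \<bullet> w)"
    using assms by (simp add: scalar_prod_eq_sum sum.distrib sum_subtractf sum_distrib_left)
  finally show ?thesis by (simp add: euclid_norm_eq)
qed

lemma abs_scalar_prod_le:
  assumes "v \<in> carrier_vec n" "w \<in> carrier_vec n"
  shows "\<bar>real_of_int (v \<bullet> w)\<bar> \<le> euclid_norm v * euclid_norm w"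
proof -
  have "\<bar>real_of_int (v \<bullet> w)\<bar> \<le> (\<Sum>j<n. \<bar>real_of_int (v $ j)\<bar> * \<bar>real_of_int (w $ j)\<bar>)"
    using assms by (simp add: scalar_prod_eq_sum flip: abs_mult)
  also have "\<dots> \<le> L2_set (\<lambda>j. real_of_int (v $ j)) {..<n} * L2_set (\<lambda>j. real_of_int (w $ j)) {..<n}"
    by (rule L2_set_mult_ineq)
  finally show ?thesis using assms by (simp add: euclid_norm_def)
qed

lemma sin_ray_angle:
  assumes "v \<in> carrier_vec n" "w \<in> carrier_vec n"
  shows "sin (ray_angle v w) = sqrt (1 - (real_of_int (v \<bullet> w) / (euclid_norm v * euclid_norm w))\<^sup>2)"
proof -
  let ?q = "real_of_int (v \<bullet> w) / (euclid_norm v * euclid_norm w)"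
  have "\<bar>?q\<bar> \<le> 1"
  proof -
    have "0 \<le> euclid_norm v * euclid_norm w" by (simp add: euclid_norm_def)
    \<comment> \<open>If a norm vanishes, the quotient is 0 by convention; otherwise this is
      Cauchy-Schwarz.\<close>
    thus ?thesis using abs_scalar_prod_le[OF assms]
      by (cases "euclid_norm v * euclid_norm w = 0") (simp_all add: divide_le_eq_1 del: mult_eq_0_iff)
  qed
  hence "- 1 \<le> ?q" "?q \<le> 1" by linarith+
  thus ?thesis unfolding ray_angle_def by (intro sin_arccos)
qed

definition equinormal :: "nat \<Rightarrow> int vec \<Rightarrow> int vec \<Rightarrow> bool" where
  "equinormal n v w \<longleftrightarrow> v \<in> carrier_vec n \<and> w \<in> carrier_vec n \<and>
     v \<bullet> v = sum_squares n \<and> w \<bullet> w = sum_squares n"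

lemma equinormal_dist:
  assumes "equinormal n v w"
  shows "normalized_dist d v w = sqrt ((2 * real_of_int (sum_squares n) - 2 * real_of_int (v \<bullet> w)) / real d ^ 3)"
proof -
  have "real d powr (3/2) = sqrt (real d ^ 3)"
    by (cases "d = 0") (simp_all add: powr_half_sqrt[symmetric] powr_powr flip: powr_numeral)
  thus ?thesis using assms
    by (simp add: normalized_dist_def equinormal_def euclid_norm_diff[of v n w] real_sqrt_divide)
qed

lemma equinormal_sin:
  assumes "equinormal n v w"
  shows "sin (ray_angle v w) = sqrt (1 - (real_of_int (v \<bullet> w) / real_of_int (sum_squares n))\<^sup>2)"
proof -
  have "0 \<le> sum_squares n" by (simp add: sum_squares_def sum_nonneg)
  hence "euclid_norm v * euclid_norm w = real_of_int (sum_squares n)"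
    using assms by (simp add: equinormal_def euclid_norm_eq)
  thus ?thesis using assms sin_ray_angle[of v n w] by (simp add: equinormal_def)
qed

text \<open>The correlation error as a function of a real variable, of order x^(11/4) (log x)^2, in
  a form suited to asymptotic evaluation.\<close>

definition dot_error :: "real \<Rightarrow> real" where
  "dot_error x = (2 * x * (1 + ln x))\<^sup>2 * (3 * x ^ 3) powr (1/4) + x\<^sup>2"

text \<open>The main term n ((n - 1)/2)^2 is the average scalar product of two random rearrangements
  of 0, ..., n - 1. The predicate is the interface between arithmetic and limits.\<close>

definition nearly_uncorrelated :: "nat \<Rightarrow> int vec \<Rightarrow> int vec \<Rightarrow> bool" where
  "nearly_uncorrelated n v w \<longleftrightarrow> equinormal n v w \<and>
     \<bar>real_of_int (v \<bullet> w) - real n * (real n - 1)\<^sup>2 / 4\<bar> \<le> dot_error (real n)"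

section \<open>Scalar products with points of the inverse family\<close>

context
  fixes p :: nat
  assumes prime_p: "prime p"
begin

interpretation prime_modulus "int p"
  by standard (use prime_p in simp)

lemma inv_shift: "(\<Sum>x\<in>{0..<int p}. f (modular_inverse (int p) (x + a))) = (\<Sum>x\<in>{0..<int p}. f (modular_inverse (int p) x))"
  using sum_affine[of 1 "\<lambda>x. f (modular_inverse (int p) x)" a] inv_cong p_gt_1 by auto

lemma inv_point_self_prod: "inv_point p h \<bullet> inv_point p h = sum_squares p"
proof -
  have "inv_point p h \<bullet> inv_point p h = (\<Sum>j<p. (modular_inverse (int p) (int j + int h))\<^sup>2)"
    unfolding scalar_prod_eq_sum[OF inv_point_carrier]
    by (intro sum.cong) (simp_all add: inv_point_index power2_eq_square add.commute)
  also have "\<dots> = (\<Sum>x\<in>{0..<int p}. (modular_inverse (int p) (x + int h))\<^sup>2)"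
    by (simp add: sum_R)
  also have "\<dots> = (\<Sum>x\<in>{0..<int p}. x\<^sup>2)"
    using inv_shift[of "\<lambda>x. x\<^sup>2" "int h"] sum_inv[of "\<lambda>x. x\<^sup>2"] by simp
  finally show ?thesis by (simp add: sum_R sum_squares_def)
qed

lemma error_eq: "corr_bound + (real_of_int (int p))\<^sup>2 = dot_error (real p)"
  by (simp add: corr_bound_def dot_error_def)

lemma inv_inv_nearly_uncorrelated:
  assumes "\<not> int p dvd int k - int h"
  shows "nearly_uncorrelated p (inv_point p h) (inv_point p k)"
proof -
  let ?i = "modular_inverse (int p)"
  define f where "f x = real_of_int (?i x) * real_of_int (?i (x + (int k - int h)))" for x
  have "real_of_int (inv_point p h \<bullet> inv_point p k) = (\<Sum>j<p. f (1 * int j + int h))"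
    unfolding scalar_prod_eq_sum[OF inv_point_carrier] of_int_sum f_def
    by (intro sum.cong) (simp_all add: inv_point_index algebra_simps)
  also have "\<dots> = (\<Sum>x\<in>{0..<int p}. f (1 * x + int h))" by (simp add: sum_R)
  also have "\<dots> = (\<Sum>x\<in>{0..<int p}. f x)"
  proof (rule sum_affine)
    show "\<not> int p dvd 1" using p_gt_1 by auto
    fix x y :: int assume xy: "[x = y] (mod (int p))"
    hence "[x + (int k - int h) = y + (int k - int h)] (mod (int p))" by (rule cong_add) simp
    thus "f x = f y" using inv_cong[OF xy] inv_cong unfolding f_def by simp
  qed
  finally show ?thesis
    using inv_inv_correlation[OF assms] inv_point_self_prod
    by (simp add: nearly_uncorrelated_def equinormal_def f_def flip: error_eq)
qed

lemma circ_inv_nearly_uncorrelated: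
  "nearly_uncorrelated p (circ_point (p - 1) h) (inv_point p k)"
proof -
  let ?i = "modular_inverse (int p)"
  have p: "Suc (p - Suc 0) = p" using prime_p prime_gt_0_nat by simp
  define f where "f x = real_of_int ((x + (int h - int k)) mod int p) * real_of_int (?i x)" for x
  have "real_of_int (circ_point (p - 1) h \<bullet> inv_point p k) = (\<Sum>j<p. f (1 * int j + int k))"
    unfolding scalar_prod_eq_sum[OF inv_point_carrier] of_int_sum f_def
  proof (intro sum.cong refl)
    fix j assume "j \<in> {..<p}"
    thus "real_of_int (circ_point (p - 1) h $ j * inv_point p k $ j) =
       real_of_int ((1 * int j + int k + (int h - int k)) mod int p) * real_of_int (?i (1 * int j + int k))"
      using circ_point_index[of j "p - 1" h] inv_point_index[of j p k] p by (simp add: zmod_int add.commute)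
  qed
  also have "\<dots> = (\<Sum>x\<in>{0..<int p}. f (1 * x + int k))" by (simp add: sum_R)
  also have "\<dots> = (\<Sum>x\<in>{0..<int p}. f x)"
  proof (rule sum_affine)
    show "\<not> int p dvd 1" using p_gt_1 by auto
    fix x y :: int assume xy: "[x = y] (mod (int p))"
    hence "[x + (int h - int k) = y + (int h - int k)] (mod (int p))" by (rule cong_add) simp
    thus "f x = f y" using inv_cong[OF xy] unfolding f_def by (simp add: Cong.cong_def)
  qed
  finally show ?thesis
    using shift_inv_correlation[of "int h - int k"] inv_point_self_prod circ_point_self_prod[of "p - 1" h]
      circ_point_carrier[of "p - 1" h]
    by (simp add: nearly_uncorrelated_def equinormal_def f_def p flip: error_eq)
qed

end

subsection \<open>Limit sets\<close>

text \<open>Convergence along every admissible choice makes L the only candidate; unboundedness and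
  nonemptiness provide one choice, so L is attained.\<close>

lemma limit_set_singletonI:
  assumes unbounded: "\<And>N. \<exists>n\<in>I. n \<ge> N" and nonempty: "\<And>n. n \<in> I \<Longrightarrow> S n \<noteq> {}"
    and lim: "\<And>n x. filterlim n at_top sequentially \<Longrightarrow> (\<And>k. n k \<in> I) \<Longrightarrow> (\<And>k. x k \<in> S (n k)) \<Longrightarrow> x \<longlonglongrightarrow> L"
  shows "limit_set I S = {L}"
proof
  show "limit_set I S \<subseteq> {L}"
    unfolding limit_set_def using lim LIMSEQ_unique by blast
  obtain n where n: "n k \<in> I" "n k \<ge> k" for k using unbounded by metis
  have "filterlim n at_top sequentially"
    using n(2) by (intro filterlim_at_top_mono[OF filterlim_ident]) auto
  moreover have "\<exists>y. y \<in> S (n k)" for k using nonempty[OF n(1)] by blast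
  then obtain x where "x k \<in> S (n k)" for k by metis
  ultimately show "{L} \<subseteq> limit_set I S"
    unfolding limit_set_def using lim n(1) by blast
qed

text \<open>Divided by n^3, squared norms tend to 1/3 and scalar products to 1/4. So the squared
  distance tends to 2/3 - 2/4 = 1/6, the cosine to 3/4, and the sine to the root of 1 -
  9/16.\<close>

lemma nearly_uncorrelated_limits:
  assumes n: "filterlim n at_top sequentially" and nu: "\<And>k. nearly_uncorrelated (n k) (v k) (w k)"
  shows "(\<lambda>k. normalized_dist (n k - 1) (v k) (w k)) \<longlonglongrightarrow> 1 / sqrt 6"
    and "(\<lambda>k. sin (ray_angle (v k) (w k))) \<longlonglongrightarrow> sqrt 7 / 4"
proof -
  define D where "D k = real_of_int (v k \<bullet> w k)" for k
  define N where "N k = real_of_int (sum_squares (n k))" for k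
  have lim: "(\<lambda>k. f (real (n k))) \<longlonglongrightarrow> c" if "(f \<longlongrightarrow> c) at_top" for f :: "real \<Rightarrow> real" and c
    using that n by (intro filterlim_compose[OF that] filterlim_compose[OF filterlim_real_sequentially]) auto
  have N: "(\<lambda>k. N k / real (n k) ^ 3) \<longlonglongrightarrow> 1 / 3"
    unfolding N_def real_sum_squares
    by (rule lim[of "\<lambda>x. x * (x - 1) * (2 * x - 1) / 6 / x ^ 3"]) real_asymp
  have E: "(\<lambda>k. dot_error (real (n k)) / real (n k) ^ 3) \<longlonglongrightarrow> 0"
    unfolding dot_error_def by (rule lim[of "\<lambda>x. ((2 * x * (1 + ln x))\<^sup>2 * (3 * x ^ 3) powr (1/4) + x\<^sup>2) / x ^ 3"]) real_asymp
  have M: "(\<lambda>k. (real (n k) * (real (n k) - 1)\<^sup>2 / 4) / real (n k) ^ 3) \<longlonglongrightarrow> 1 / 4"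
    by (rule lim[of "\<lambda>x. (x * (x - 1)\<^sup>2 / 4) / x ^ 3"]) real_asymp
  have "(\<lambda>k. (D k - real (n k) * (real (n k) - 1)\<^sup>2 / 4) / real (n k) ^ 3) \<longlonglongrightarrow> 0"
  proof (rule tendsto_0_le[OF E, of _ 1], rule always_eventually, rule allI)
    fix k
    have "\<bar>dot_error (real (n k))\<bar> = dot_error (real (n k))"
      by (simp add: dot_error_def)
    moreover have "norm ((D k - real (n k) * (real (n k) - 1)\<^sup>2 / 4) / real (n k) ^ 3) \<le> dot_error (real (n k)) / real (n k) ^ 3"
      using nu[of k] by (simp add: nearly_uncorrelated_def D_def divide_right_mono)
    ultimately show "norm ((D k - real (n k) * (real (n k) - 1)\<^sup>2 / 4) / real (n k) ^ 3)
        \<le> norm (dot_error (real (n k)) / real (n k) ^ 3) * 1" by simp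
  qed
  from tendsto_add[OF this M] have D: "(\<lambda>k. D k / real (n k) ^ 3) \<longlonglongrightarrow> 1 / 4"
    by (simp add: diff_divide_distrib)
  have pos: "eventually (\<lambda>k. n k \<ge> 2) sequentially" using n by (simp add: filterlim_at_top)
  \<comment> \<open>Distances are normalized with d = n - 1 instead of n.\<close>
  have R: "(\<lambda>k. real (n k) ^ 3 / (real (n k) - 1) ^ 3) \<longlonglongrightarrow> 1"
    by (rule lim[of "\<lambda>x. x ^ 3 / (x - 1) ^ 3"]) real_asymp
  have eq: "equinormal (n k) (v k) (w k)" for k using nu by (simp add: nearly_uncorrelated_def)
  have "(\<lambda>k. sqrt ((2 * (N k / real (n k) ^ 3) - 2 * (D k / real (n k) ^ 3)) * (real (n k) ^ 3 / (real (n k) - 1) ^ 3)))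
     \<longlonglongrightarrow> sqrt ((2 * (1 / 3) - 2 * (1 / 4)) * 1)"
    by (intro tendsto_intros N D R)
  also have "sqrt ((2 * (1 / 3) - 2 * (1 / 4)) * 1) = 1 / sqrt 6"
    by (simp add: real_sqrt_divide)
  finally show "(\<lambda>k. normalized_dist (n k - 1) (v k) (w k)) \<longlonglongrightarrow> 1 / sqrt 6"
  proof (rule Lim_transform_eventually)
    show "\<forall>\<^sub>F k in sequentially. sqrt ((2 * (N k / real (n k) ^ 3) - 2 * (D k / real (n k) ^ 3)) * (real (n k) ^ 3 / (real (n k) - 1) ^ 3))
       = normalized_dist (n k - 1) (v k) (w k)"
      using pos
    proof eventually_elim
      case (elim k)
      thus ?case by (simp add: equinormal_dist[OF eq] N_def D_def of_nat_diff flip: diff_divide_distrib)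
    qed
  qed
  have "(\<lambda>k. sqrt (1 - ((D k / real (n k) ^ 3) / (N k / real (n k) ^ 3))\<^sup>2)) \<longlonglongrightarrow> sqrt (1 - ((1/4) / (1/3))\<^sup>2)"
    by (intro tendsto_intros N D) auto
  also have "sqrt (1 - ((1/4) / (1/3))\<^sup>2) = sqrt 7 / 4"
    using real_sqrt_divide[of 7 16] by (simp add: power2_eq_square)
  finally show "(\<lambda>k. sin (ray_angle (v k) (w k))) \<longlonglongrightarrow> sqrt 7 / 4"
  proof (rule Lim_transform_eventually)
    show "\<forall>\<^sub>F k in sequentially. sqrt (1 - ((D k / real (n k) ^ 3) / (N k / real (n k) ^ 3))\<^sup>2)
       = sin (ray_angle (v k) (w k))"
      using pos
    proof eventually_elim
      case (elim k)
      thus ?case by (simp add: equinormal_sin[OF eq] N_def D_def)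
    qed
  qed
qed

lemma nearly_uncorrelated_limit_sets:
  assumes unbounded: "\<And>N. \<exists>n\<in>I. n \<ge> N"
    and nonempty: "\<And>n. n \<in> I \<Longrightarrow> \<exists>v w. Q n v w"
    and nu: "\<And>n v w. n \<in> I \<Longrightarrow> Q n v w \<Longrightarrow> nearly_uncorrelated n v w"
  shows "limit_set I (\<lambda>n. {normalized_dist (n - 1) v w | v w. Q n v w}) = {1 / sqrt 6}"
    and "limit_set I (\<lambda>n. {sin (ray_angle v w) | v w. Q n v w}) = {sqrt 7 / 4}"
proof -
  show "limit_set I (\<lambda>n. {normalized_dist (n - 1) v w | v w. Q n v w}) = {1 / sqrt 6}"
  proof (rule limit_set_singletonI)
    fix n :: "nat \<Rightarrow> nat" and x :: "nat \<Rightarrow> real"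
    assume *: "filterlim n at_top sequentially" "\<And>k. n k \<in> I"
      "\<And>k. x k \<in> {normalized_dist (n k - 1) v w | v w. Q (n k) v w}"
    hence "\<forall>k. \<exists>v w. x k = normalized_dist (n k - 1) v w \<and> Q (n k) v w" by blast
    then obtain v w where vw: "x k = normalized_dist (n k - 1) (v k) (w k)" "Q (n k) (v k) (w k)" for k
      by metis
    have "x = (\<lambda>k. normalized_dist (n k - 1) (v k) (w k))" using vw(1) by blast
    thus "x \<longlonglongrightarrow> 1 / sqrt 6"
      using nearly_uncorrelated_limits(1)[OF *(1), of v w] nu[OF *(2) vw(2)] by simp
  qed (use unbounded nonempty in blast)+
  show "limit_set I (\<lambda>n. {sin (ray_angle v w) | v w. Q n v w}) = {sqrt 7 / 4}"
  proof (rule limit_set_singletonI)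
    fix n :: "nat \<Rightarrow> nat" and x :: "nat \<Rightarrow> real"
    assume *: "filterlim n at_top sequentially" "\<And>k. n k \<in> I"
      "\<And>k. x k \<in> {sin (ray_angle v w) | v w. Q (n k) v w}"
    hence "\<forall>k. \<exists>v w. x k = sin (ray_angle v w) \<and> Q (n k) v w" by blast
    then obtain v w where vw: "x k = sin (ray_angle (v k) (w k))" "Q (n k) (v k) (w k)" for k
      by metis
    have "x = (\<lambda>k. sin (ray_angle (v k) (w k)))" using vw(1) by blast
    thus "x \<longlonglongrightarrow> sqrt 7 / 4"
      using nearly_uncorrelated_limits(2)[OF *(1), of v w] nu[OF *(2) vw(2)] by simp
  qed (use unbounded nonempty in blast)+
qed

text \<open>Compactness of [0, 1] gives one inclusion and density of the fractions t/(d + 1) the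
  other. Convergence of \<open>G\<close> is required along sequences whose fractions converge, which
  is what both directions use.\<close>

lemma limit_set_intervalI:
  fixes G :: "nat \<Rightarrow> nat \<Rightarrow> real" and F :: "real \<Rightarrow> real"
  assumes S: "\<And>d. d \<ge> 2 \<Longrightarrow> S d = G d ` {1..d}"
    and G: "\<And>n t \<theta>. filterlim n at_top sequentially \<Longrightarrow>
      (\<lambda>k. real (t k) / (real (n k) + 1)) \<longlonglongrightarrow> \<theta> \<Longrightarrow> (\<lambda>k. G (n k) (t k)) \<longlonglongrightarrow> F \<theta>"
  shows "limit_set {d. d \<ge> 2} S = F ` {0..1}"
proof
  show "limit_set {d. d \<ge> 2} S \<subseteq> F ` {0..1}"
  proof
    fix y assume "y \<in> limit_set {d. d \<ge> 2} S"
    then obtain n x where n: "filterlim n at_top sequentially" and nx: "\<And>k. n k \<ge> 2 \<and> x k \<in> S (n k)"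
      and x: "x \<longlonglongrightarrow> y" unfolding limit_set_def by auto
    have "\<exists>t. t \<in> {1..n k} \<and> x k = G (n k) t" for k
      using nx[of k] S[of "n k"] by auto
    then obtain t where t: "\<And>k. t k \<in> {1..n k}" "\<And>k. x k = G (n k) (t k)" by metis
    define q where "q k = real (t k) / (real (n k) + 1)" for k
    have q: "0 \<le> q k" "q k \<le> 1" for k
      using t(1)[of k] by (simp_all add: q_def)
    \<comment> \<open>Bolzano-Weierstrass: a monotone subsequence of a bounded sequence
      converges.\<close>
    obtain r :: "nat \<Rightarrow> nat" where r: "strict_mono r" "monoseq (\<lambda>k. q (r k))"
      using seq_monosub[of q] by blast
    have "Bseq (\<lambda>k. q (r k))"
      using q by (intro BseqI'[of _ 1]) simp
    then obtain \<theta> where lim: "(\<lambda>k. q (r k)) \<longlonglongrightarrow> \<theta>"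
      using Bseq_monoseq_convergent r(2) convergent_def by blast
    have \<theta>: "\<theta> \<in> {0..1}"
      using LIMSEQ_le_const[OF lim, of 0] LIMSEQ_le_const2[OF lim, of 1] q by auto
    have nr: "filterlim (n \<circ> r) at_top sequentially"
      unfolding comp_def by (intro filterlim_compose[OF n] filterlim_subseq r)
    have "(\<lambda>k. real ((t \<circ> r) k) / (real ((n \<circ> r) k) + 1)) \<longlonglongrightarrow> \<theta>"
      using lim by (simp add: q_def comp_def)
    from G[OF nr this] have "(x \<circ> r) \<longlonglongrightarrow> F \<theta>" by (simp add: comp_def t(2))
    moreover have "(x \<circ> r) \<longlonglongrightarrow> y" using LIMSEQ_subseq_LIMSEQ[OF x r(1)] .
    ultimately show "y \<in> F ` {0..1}" using \<theta> LIMSEQ_unique by blast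
  qed
  show "F ` {0..1} \<subseteq> limit_set {d. d \<ge> 2} S"
  proof
    fix y assume "y \<in> F ` {0..1}"
    then obtain \<theta> where \<theta>: "0 \<le> \<theta>" "\<theta> \<le> 1" "y = F \<theta>" by auto
    define n :: "nat \<Rightarrow> nat" where "n k = k + 2" for k
    \<comment> \<open>The floor can be 0 for small \<theta> and n + 1 for \<theta> = 1; clamping it
      into {1..n} keeps it within 1 of \<theta> (n + 1).\<close>
    define t where "t k = max 1 (min (n k) (nat \<lfloor>\<theta> * (real (n k) + 1)\<rfloor>))" for k
    have t: "t k \<in> {1..n k}" for k by (simp add: t_def n_def)
    have n: "filterlim n at_top sequentially"
      unfolding n_def by (intro filterlim_at_top_mono[OF filterlim_ident]) auto
    have close: "\<bar>real (t k) / (real (n k) + 1) - \<theta>\<bar> \<le> 1 / (real (n k) + 1)" for k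
    proof -
      define u where "u = \<theta> * (real (n k) + 1)"
      have u: "0 \<le> u" "u \<le> real (n k) + 1"
        using \<theta> mult_right_mono[of \<theta> 1 "real (n k) + 1"] by (simp_all add: u_def)
      define m where "m = nat \<lfloor>u\<rfloor>"
      have f: "real m \<le> u" "u < real m + 1" using u unfolding m_def by linarith+
      have tk: "t k = max 1 (min (n k) (m))" by (simp add: t_def u_def m_def)
      have "\<bar>real (t k) - u\<bar> \<le> 1"
      proof (cases "m = 0")
        case True
        hence "t k = 1" by (simp add: tk)
        thus ?thesis using f True u by simp
      next
        case False
        show ?thesis
        proof (cases "m \<le> n k")
          case True
          hence "t k = m" using False by (simp add: tk)
          thus ?thesis using f by simp
        next
          case False
          hence "t k = n k" by (simp add: tk n_def)
          thus ?thesis using f False u by simp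
        qed
      qed
      moreover have "real (t k) / (real (n k) + 1) - \<theta> = (real (t k) - u) / (real (n k) + 1)"
        by (simp add: u_def field_simps)
      ultimately show ?thesis by (simp add: divide_right_mono)
    qed
    have "(\<lambda>k. 1 / (real (n k) + 1)) \<longlonglongrightarrow> 0"
      unfolding n_def by real_asymp
    hence "(\<lambda>k. real (t k) / (real (n k) + 1) - \<theta>) \<longlonglongrightarrow> 0"
      by (rule tendsto_0_le[of _ _ _ 1]) (use close in simp)
    hence "(\<lambda>k. real (t k) / (real (n k) + 1)) \<longlonglongrightarrow> \<theta>" by (simp add: LIM_zero_iff)
    from G[OF n this] have "(\<lambda>k. G (n k) (t k)) \<longlonglongrightarrow> y" by (simp add: \<theta>(3))
    moreover have "G (n k) (t k) \<in> S (n k)" "n k \<ge> 2" for k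
      using t[of k] S[of "n k"] by (auto simp: n_def)
    ultimately have "filterlim n at_top sequentially \<and>
        (\<forall>k. n k \<in> {d. d \<ge> 2} \<and> G (n k) (t k) \<in> S (n k)) \<and> (\<lambda>k. G (n k) (t k)) \<longlonglongrightarrow> y"
      using n by simp
    thus "y \<in> limit_set {d. d \<ge> 2} S"
      unfolding limit_set_def mem_Collect_eq
      by (intro exI[of _ n] exI[of _ "\<lambda>k. G (n k) (t k)"])
  qed
qed

section \<open>Distances and angles within the circulant family\<close>

lemma sum_square_differences:
  assumes "t < n"
  shows "(\<Sum>x<n. (int x - int ((x + t) mod n))\<^sup>2) = int n * int t * (int n - int t)"
proof -
  \<comment> \<open>The first n - t places do not wrap and contribute t^2 each; the last t wrap and
    contribute (n - t)^2 each.\<close>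
  have split: "{..<n} = {..<n - t} \<union> {n - t..<n}" by auto
  have "(\<Sum>x<n. (int x - int ((x + t) mod n))\<^sup>2) =
     (\<Sum>x<n - t. (int x - int ((x + t) mod n))\<^sup>2) + (\<Sum>x=n - t..<n. (int x - int ((x + t) mod n))\<^sup>2)"
    by (subst split, rule sum.union_disjoint) auto
  also have "(\<Sum>x<n - t. (int x - int ((x + t) mod n))\<^sup>2) = (\<Sum>x<n - t. (int t)\<^sup>2)"
    by (intro sum.cong) auto
  also have "(\<Sum>x=n - t..<n. (int x - int ((x + t) mod n))\<^sup>2) = (\<Sum>x=n - t..<n. (int n - int t)\<^sup>2)"
  proof (intro sum.cong refl)
    fix x assume x: "x \<in> {n - t..<n}"
    hence "(x + t) mod n = x + t - n" using assms by (subst mod_if) (auto simp: mod_if)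
    thus "(int x - int ((x + t) mod n))\<^sup>2 = (int n - int t)\<^sup>2"
    proof -
      have "n \<le> x + t" using x by auto
      thus ?thesis using \<open>(x + t) mod n = x + t - n\<close> by (simp add: of_nat_diff)
    qed
  qed
  finally show ?thesis using assms by (simp add: of_nat_diff power2_eq_square algebra_simps)
qed

lemma circ_equinormal: "equinormal (Suc d) (circ_point d h) (circ_point d k)"
  by (simp add: equinormal_def circ_point_self_prod)

text \<open>Polarization from the squared distance and the equal norms. The number t is k - h modulo
  d + 1, written with \<open>Suc d - h\<close> to stay within the naturals; the factor 2 avoids
  dividing integers.\<close>

lemma circ_scalar_prod:
  fixes d h k :: nat
  defines "t \<equiv> (k + (Suc d - h)) mod Suc d"
  assumes "h \<le> d"
  shows "2 * (circ_point d h \<bullet> circ_point d k) = 2 * sum_squares (Suc d) - int (Suc d) * int t * (int (Suc d) - int t)"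
proof -
  let ?n = "Suc d"
  let ?v = "circ_point d h" and ?w = "circ_point d k"
  have kt: "(k + j) mod ?n = ((h + j) mod ?n + t) mod ?n" for j
  proof -
    have "((h + j) mod ?n + t) mod ?n = (h + j + (k + (?n - h))) mod ?n"
      unfolding t_def by (simp add: mod_simps)
    also have "h + j + (k + (?n - h)) = k + j + ?n" using assms(2) by simp
    finally show ?thesis by (simp only: mod_add_self2)
  qed
  have "?v \<bullet> ?v + ?w \<bullet> ?w - 2 * (?v \<bullet> ?w) = (\<Sum>j<?n. (?v $ j - ?w $ j)\<^sup>2)"
    unfolding scalar_prod_eq_sum[OF circ_point_carrier] sum_distrib_left sum.distrib[symmetric] sum_subtractf[symmetric]
    by (intro sum.cong refl) (simp add: power2_eq_square algebra_simps)
  also have "\<dots> = (\<Sum>j<?n. (int ((h + j) mod ?n) - int (((h + j) mod ?n + t) mod ?n))\<^sup>2)"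
    by (intro sum.cong refl) (simp only: circ_point_index lessThan_iff kt)
  also have "\<dots> = (\<Sum>x<?n. (int x - int ((x + t) mod ?n))\<^sup>2)"
    by (rule sum_shift_mod) simp
  also have "\<dots> = int ?n * int t * (int ?n - int t)"
    by (rule sum_square_differences) (simp add: t_def)
  finally show ?thesis by (simp add: circ_point_self_prod)
qed

lemma not_dvd_diff:
  assumes "h < n" "k < n" "h \<noteq> k"
  shows "\<not> int n dvd int k - int h"
proof
  assume "int n dvd int k - int h"
  hence "int k mod int n = int h mod int n" unfolding mod_eq_dvd_iff .
  thus False using assms by simp
qed

text \<open>Distinct points correspond to nonzero shifts t, and each shift is realized by the points
  0 and t. A general \<open>g\<close> serves distances and sines alike.\<close>

lemma circ_pairs_image:
  fixes f :: "int vec \<Rightarrow> int vec \<Rightarrow> real" and g :: "real \<Rightarrow> real"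
  assumes f: "\<And>v w. v \<in> circ_set d \<Longrightarrow> w \<in> circ_set d \<Longrightarrow> f v w = g (real_of_int (v \<bullet> w))"
  shows "{f v w | v w. v \<in> circ_set d \<and> w \<in> circ_set d \<and> v \<noteq> w} =
    (\<lambda>t. g (real_of_int (sum_squares (Suc d)) - (real d + 1) * real t * (real d + 1 - real t) / 2)) ` {1..d}"
    (is "?L = ?h ` _")
proof -
  have eq: "f (circ_point d h) (circ_point d k) = ?h ((k + (Suc d - h)) mod Suc d)"
    if "h \<le> d" "k \<le> d" for h k
  proof -
    have "2 * real_of_int (circ_point d h \<bullet> circ_point d k) = real_of_int (2 * (circ_point d h \<bullet> circ_point d k))"
      by simp
    also have "\<dots> = 2 * real_of_int (sum_squares (Suc d)) - (real d + 1) * real ((k + (Suc d - h)) mod Suc d) * (real d + 1 - real ((k + (Suc d - h)) mod Suc d))"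
      unfolding circ_scalar_prod[OF that(1)] by (simp add: add.commute)
    finally have "real_of_int (circ_point d h \<bullet> circ_point d k) = real_of_int (sum_squares (Suc d)) -
        (real d + 1) * real ((k + (Suc d - h)) mod Suc d) * (real d + 1 - real ((k + (Suc d - h)) mod Suc d)) / 2"
      by simp
    thus ?thesis using f[of "circ_point d h" "circ_point d k"] that by (simp add: circ_set_def)
  qed
  show ?thesis
  proof
    show "?L \<subseteq> ?h ` {1..d}"
    proof
      fix y assume "y \<in> ?L"
      then obtain h k where hk: "h \<le> d" "k \<le> d" "circ_point d h \<noteq> circ_point d k" "y = f (circ_point d h) (circ_point d k)"
        by (auto simp: circ_set_def)
      define t where "t = (k + (Suc d - h)) mod Suc d"
      have "t \<noteq> 0"
      proof
        assume "t = 0"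
        hence "Suc d dvd k + (Suc d - h)" by (simp add: t_def dvd_eq_mod_eq_0)
        hence "int (Suc d) dvd int (k + (Suc d - h))" by (simp only: of_nat_dvd_iff)
        also have "int (k + (Suc d - h)) = int k - int h + int (Suc d)"
          using hk(1) by (simp add: of_nat_diff)
        finally have "int (Suc d) dvd int k - int h" by (simp only: dvd_add_triv_right_iff)
        hence "h = k" using not_dvd_diff[of h "Suc d" k] hk(1,2) by auto
        thus False using hk(3) by simp
      qed
      moreover have "t < Suc d" by (simp add: t_def)
      ultimately have "t \<in> {1..d}" by simp
      thus "y \<in> ?h ` {1..d}" using eq[OF hk(1,2)] hk(4) unfolding t_def by blast
    qed
    show "?h ` {1..d} \<subseteq> ?L"
    proof
      fix y assume "y \<in> ?h ` {1..d}"
      then obtain t where t: "t \<in> {1..d}" "y = ?h t" by blast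
      have "(t + (Suc d - 0)) mod Suc d = t"
        using t(1) by (simp only: diff_zero mod_add_self2) simp
      hence "y = f (circ_point d 0) (circ_point d t)" using eq[of 0 t] t by simp
      moreover have "circ_point d 0 \<noteq> circ_point d t"
        using circ_point_index[of 0 d 0] circ_point_index[of 0 d t] t(1) by auto
      moreover have "circ_point d 0 \<in> circ_set d" "circ_point d t \<in> circ_set d"
        using t(1) by (auto simp: circ_set_def)
      ultimately show "y \<in> ?L" by blast
    qed
  qed
qed

lemma product_of_complements_surj:
  fixes q :: real
  assumes "0 \<le> q" "q \<le> 1 / 4"
  obtains \<theta> where "0 \<le> \<theta>" "\<theta> \<le> 1" "\<theta> * (1 - \<theta>) = q"
proof -
  \<comment> \<open>The root of the discriminant of \<theta>^2 - \<theta> + q; the smaller solution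
    is taken.\<close>
  define s where "s = sqrt (1 - 4 * q)"
  have s: "0 \<le> s" "s \<le> 1" "s * s = 1 - 4 * q" using assms by (simp_all add: s_def)
  show ?thesis
  proof (rule that[of "(1 - s) / 2"])
    show "0 \<le> (1 - s) / 2" "(1 - s) / 2 \<le> 1" using s(1,2) by simp_all
    show "(1 - s) / 2 * (1 - (1 - s) / 2) = q" using s(3) by (simp add: field_simps)
  qed
qed

lemma product_of_complements_le: "\<theta> * (1 - \<theta>) \<le> (1 / 4 :: real)"
  using zero_le_power2[of "\<theta> - 1 / 2"] by (simp add: power2_eq_square algebra_simps)

lemma circ_dist_limit_set:
  "limit_set {d. d \<ge> 2} (\<lambda>d. {normalized_dist d v w | v w. v \<in> circ_set d \<and> w \<in> circ_set d \<and> v \<noteq> w}) = {0..1 / 2}"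
    (is "limit_set _ ?S = _")
proof -
  define F where "F \<theta> = sqrt (\<theta> * (1 - \<theta>))" for \<theta> :: real
  define G where "G d t = sqrt ((2 * real_of_int (sum_squares (Suc d)) - 2 * (real_of_int (sum_squares (Suc d)) -
      (real d + 1) * real t * (real d + 1 - real t) / 2)) / real d ^ 3)" for d t
  have "limit_set {d. d \<ge> 2} ?S = F ` {0..1}"
  proof (rule limit_set_intervalI)
    fix d :: nat
    show "?S d = G d ` {1..d}"
      unfolding G_def
      by (rule circ_pairs_image) (auto simp: circ_set_def equinormal_dist[OF circ_equinormal])
  next
    fix n t :: "nat \<Rightarrow> nat" and \<theta> :: real
    assume n: "filterlim n at_top sequentially" and t: "(\<lambda>k. real (t k) / (real (n k) + 1)) \<longlonglongrightarrow> \<theta>"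
    have R: "(\<lambda>k. (real (n k) + 1) ^ 3 / real (n k) ^ 3) \<longlonglongrightarrow> 1"
      by (rule filterlim_compose[OF filterlim_compose[OF _ filterlim_real_sequentially] n, of "\<lambda>x. (x + 1) ^ 3 / x ^ 3"]) real_asymp
    have "(\<lambda>k. sqrt (real (t k) / (real (n k) + 1) * (1 - real (t k) / (real (n k) + 1)) * ((real (n k) + 1) ^ 3 / real (n k) ^ 3)))
      \<longlonglongrightarrow> sqrt (\<theta> * (1 - \<theta>) * 1)"
      by (intro tendsto_intros t R)
    \<comment> \<open>Division by zero gives 0 on both sides, so the two sequences agree at every
      index, even where \<open>n k = 0\<close>.\<close>
    moreover have "a / b * (1 - a / b) * (b ^ 3 / c) = (2 * s - 2 * (s - b * a * (b - a) / 2)) / c"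
      if "b > 0" for a b c s :: real
      using that by (cases "c = 0") (simp_all add: field_simps power3_eq_cube)
    ultimately show "(\<lambda>k. G (n k) (t k)) \<longlonglongrightarrow> F \<theta>" by (simp add: G_def F_def)
  qed
  also have "F ` {0..1} = {0..1 / 2}"
  proof
    show "F ` {0..1} \<subseteq> {0..1 / 2}"
    proof
      fix y assume "y \<in> F ` {0..1}"
      then obtain \<theta> where \<theta>: "0 \<le> \<theta>" "\<theta> \<le> 1" "y = F \<theta>" by auto
      have "sqrt (\<theta> * (1 - \<theta>)) \<le> sqrt (1 / 4)"
        using product_of_complements_le by (rule real_sqrt_le_mono)
      thus "y \<in> {0..1 / 2}" using \<theta> by (simp add: F_def real_sqrt_divide)
    qed
    show "{0..1 / 2} \<subseteq> F ` {0..1}"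
    proof
      fix y :: real assume y: "y \<in> {0..1 / 2}"
      have "y\<^sup>2 \<le> (1 / 2)\<^sup>2" using y by (intro power_mono) auto
      hence "y\<^sup>2 \<le> 1 / 4" by (simp add: power_divide)
      then obtain \<theta> where \<theta>: "0 \<le> \<theta>" "\<theta> \<le> 1" "\<theta> * (1 - \<theta>) = y\<^sup>2"
        using product_of_complements_surj[of "y\<^sup>2"] by auto
      hence "F \<theta> = y" using y by (simp add: F_def)
      thus "y \<in> F ` {0..1}" using \<theta> by force
    qed
  qed
  finally show ?thesis .
qed

lemma circ_Spec_limit_set:
  "limit_set {d. d \<ge> 2} (\<lambda>d. Spec (circ_set d)) = {0..sqrt 39 / 8}"
proof -
  \<comment> \<open>The factor 3/2 is the limit of half the squared distance, n^3 \<theta> (1 -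
    \<theta>) / 2, over the squared norm, about n^3 / 3.\<close>
  define F where "F \<theta> = sqrt (1 - (1 - 3 / 2 * (\<theta> * (1 - \<theta>)))\<^sup>2)" for \<theta> :: real
  define G where "G d t = sqrt (1 - ((real_of_int (sum_squares (Suc d)) -
      (real d + 1) * real t * (real d + 1 - real t) / 2) / real_of_int (sum_squares (Suc d)))\<^sup>2)" for d t
  have "limit_set {d. d \<ge> 2} (\<lambda>d. Spec (circ_set d)) = F ` {0..1}"
  proof (rule limit_set_intervalI)
    fix d :: nat
    show "Spec (circ_set d) = G d ` {1..d}"
      unfolding G_def Spec2_def
      by (rule circ_pairs_image) (auto simp: circ_set_def equinormal_sin[OF circ_equinormal])
  next
    fix n t :: "nat \<Rightarrow> nat" and \<theta> :: real
    assume n: "filterlim n at_top sequentially" and t: "(\<lambda>k. real (t k) / (real (n k) + 1)) \<longlonglongrightarrow> \<theta>"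
    let ?q = "\<lambda>k. real (t k) / (real (n k) + 1)"
    have R: "(\<lambda>k. (real (n k) + 1) ^ 3 / (2 * ((real (n k) + 1) * real (n k) * (2 * real (n k) + 1) / 6))) \<longlonglongrightarrow> 3 / 2"
      by (rule filterlim_compose[OF filterlim_compose[OF _ filterlim_real_sequentially] n, of "\<lambda>x. (x + 1) ^ 3 / (2 * ((x + 1) * x * (2 * x + 1) / 6))"]) real_asymp
    have L: "(\<lambda>k. sqrt (1 - (1 - (?q k * (1 - ?q k)) * ((real (n k) + 1) ^ 3 / (2 * ((real (n k) + 1) * real (n k) * (2 * real (n k) + 1) / 6))))\<^sup>2))
      \<longlonglongrightarrow> sqrt (1 - (1 - (\<theta> * (1 - \<theta>)) * (3 / 2))\<^sup>2)"
      by (intro tendsto_intros t R)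
    have alg: "1 - a / b * (1 - a / b) * (b ^ 3 / (2 * s)) = (s - b * a * (b - a) / 2) / s"
      if "b > 0" "s > 0" for a b s :: real
      using that by (simp add: field_simps power3_eq_cube)
    have pos: "eventually (\<lambda>k. n k \<ge> 2) sequentially" using n by (simp add: filterlim_at_top)
    have "(\<lambda>k. G (n k) (t k)) \<longlonglongrightarrow> sqrt (1 - (1 - (\<theta> * (1 - \<theta>)) * (3 / 2))\<^sup>2)"
      using L
    proof (rule Lim_transform_eventually)
      show "\<forall>\<^sub>F k in sequentially. sqrt (1 - (1 - (?q k * (1 - ?q k)) * ((real (n k) + 1) ^ 3 / (2 * ((real (n k) + 1) * real (n k) * (2 * real (n k) + 1) / 6))))\<^sup>2)
         = G (n k) (t k)"
        using pos
      proof eventually_elim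
        case (elim k)
        have s: "real_of_int (sum_squares (Suc (n k))) = (real (n k) + 1) * real (n k) * (2 * real (n k) + 1) / 6"
          by (simp add: real_sum_squares algebra_simps)
        have "0 < (real (n k) + 1) * real (n k) * (2 * real (n k) + 1) / 6" using elim by simp
        thus ?case unfolding G_def s by (subst alg) simp_all
      qed
    qed
    thus "(\<lambda>k. G (n k) (t k)) \<longlonglongrightarrow> F \<theta>" by (simp add: F_def mult.commute)
  qed
  also have "F ` {0..1} = {0..sqrt 39 / 8}"
  proof
    show "F ` {0..1} \<subseteq> {0..sqrt 39 / 8}"
    proof
      fix y assume "y \<in> F ` {0..1}"
      then obtain \<theta> where \<theta>: "0 \<le> \<theta>" "\<theta> \<le> 1" "y = F \<theta>" by auto
      let ?c = "1 - 3 / 2 * (\<theta> * (1 - \<theta>))"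
      \<comment> \<open>The smallest cosine is 1 - 3/2 * 1/4 = 5/8, and 1 - 25/64 = 39/64. Its
        positivity makes squaring monotone.\<close>
      have c: "5 / 8 \<le> ?c" "?c \<le> 1" using product_of_complements_le[of \<theta>] \<theta> by simp_all
      have "(5 / 8)\<^sup>2 \<le> ?c\<^sup>2" "?c\<^sup>2 \<le> 1\<^sup>2" using c by (intro power_mono; simp)+
      hence "0 \<le> 1 - ?c\<^sup>2" "1 - ?c\<^sup>2 \<le> 39 / 64" by (simp_all add: power_divide)
      hence "0 \<le> y" "y \<le> sqrt (39 / 64)" unfolding \<theta>(3) F_def by simp_all
      moreover have "sqrt (39 / 64) = sqrt 39 / (8 :: real)"
        using real_sqrt_abs[of 8] by (simp add: real_sqrt_divide)
      ultimately show "y \<in> {0..sqrt 39 / 8}" by simp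
    qed
    show "{0..sqrt 39 / 8} \<subseteq> F ` {0..1}"
    proof
      fix y :: real assume y: "y \<in> {0..sqrt 39 / 8}"
      have "y\<^sup>2 \<le> (sqrt 39 / 8)\<^sup>2" using y by (intro power_mono) auto
      hence y2: "y\<^sup>2 \<le> 39 / 64" by (simp add: power_divide)
      \<comment> \<open>The cosine belonging to the sine y; solving for \<theta> (1 - \<theta>)
        gives 2/3 (1 - c), which is at most 1/4 because c \<ge> 5/8.\<close>
      let ?c = "sqrt (1 - y\<^sup>2)"
      have "sqrt ((5 / 8)\<^sup>2) \<le> ?c" using y2 by (intro real_sqrt_le_mono) (simp add: power_divide)
      hence c: "5 / 8 \<le> ?c" "?c \<le> 1" "?c\<^sup>2 = 1 - y\<^sup>2" using y2 by simp_all
      then obtain \<theta> where \<theta>: "0 \<le> \<theta>" "\<theta> \<le> 1" "\<theta> * (1 - \<theta>) = 2 / 3 * (1 - ?c)"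
        using product_of_complements_surj[of "2 / 3 * (1 - ?c)"] by auto
      have "F \<theta> = sqrt (1 - ?c\<^sup>2)"
      proof -
        have "1 - 3 / 2 * (2 / 3 * (1 - c)) = c" for c :: real by (simp add: field_simps)
        thus ?thesis unfolding F_def \<theta>(3) by (simp only:)
      qed
      also have "\<dots> = y" unfolding c(3) using y by simp
      finally show "y \<in> F ` {0..1}" using \<theta> by force
    qed
  qed
  finally show ?thesis .
qed

subsection \<open>Visibility\<close>

lemma visible_from_originI: "1 \<in> vec_set v \<Longrightarrow> visible_from_origin v"
  unfolding visible_from_origin_def by (rule Gcd_1)

lemma mutually_visibleI:
  assumes "v \<in> carrier_vec n" "w \<in> carrier_vec n"
    and "\<And>D. (\<And>j. j < n \<Longrightarrow> D dvd v $ j - w $ j) \<Longrightarrow> D dvd 1"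
  shows "mutually_visible v w"
proof -
  let ?D = "Gcd (vec_set (v - w))"
  have "?D dvd v $ j - w $ j" if "j < n" for j
  proof (rule Gcd_dvd)
    show "v $ j - w $ j \<in> vec_set (v - w)"
      using vec_setI[of "v - w" j] assms(1,2) that by auto
  qed
  hence "?D dvd 1" by (rule assms(3))
  moreover have "?D \<ge> 0" by simp
  ultimately show ?thesis unfolding mutually_visible_def by simp
qed

lemma circ_point_visible:
  assumes "d \<ge> 1"
  shows "visible_from_origin (circ_point d h)"
proof (rule visible_from_originI)
  obtain j where j: "j < Suc d" "(h + j) mod Suc d = 1"
    using shift_mod_surj[of 1 "Suc d" h] assms by auto
  thus "1 \<in> vec_set (circ_point d h)"
    using vec_setI[of "circ_point d h" j] circ_point_index[of j d h] circ_point_carrier[of d h] by auto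
qed

context
  fixes p :: nat
  assumes prime_p: "prime p"
begin

interpretation prime_modulus "int p"
  by standard (use prime_p in simp)

lemma inv_point_visible: "visible_from_origin (inv_point p h)"
proof (rule visible_from_originI)
  obtain j where j: "j < p" "(h + j) mod p = 1"
    using shift_mod_surj[of 1 p h] p_gt_1 by auto
  have "modular_inverse (int p) (int (h + j)) = modular_inverse (int p) 1"
  proof (rule inv_cong)
    show "[int (h + j) = 1] (mod (int p))"
      using j(2) p_gt_1 by (simp add: Cong.cong_def flip: zmod_int of_nat_add)
  qed
  hence "inv_point p h $ j = 1" using j(1) p_gt_1 by (simp add: inv_point_index)
  thus "1 \<in> vec_set (inv_point p h)"
    using vec_setI[of "inv_point p h" j] j(1) inv_point_carrier[of p h] by auto
qed

text \<open>The p coordinates run through a complete residue system, and periodicity extends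
  divisibility to all integers; the divisor criteria can then be applied at any convenient x,
  whatever the starting index of the point.\<close>

lemma dvd_all_shifts:
  assumes D: "\<And>j. j < p \<Longrightarrow> D dvd F (int j + b)"
    and F: "\<And>x y. [x = y] (mod int p) \<Longrightarrow> F x = F y"
  shows "D dvd F x"
proof -
  have "0 \<le> (x - b) mod int p" "(x - b) mod int p < int p" using p_pos by simp_all
  then obtain j where j: "j < p" "int j = (x - b) mod int p" by (intro that[of "nat ((x - b) mod int p)"]) auto
  have "[int j + b = x] (mod int p)" by (simp add: j(2) Cong.cong_def mod_simps)
  from F[OF this] D[OF j(1)] show ?thesis by simp
qed

lemma inv_inv_visible:
  assumes "h < p" "k < p" "h \<noteq> k"
  shows "mutually_visible (inv_point p k) (inv_point p h)"
proof (rule mutually_visibleI)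
  let ?i = "modular_inverse (int p)"
  fix D assume D: "\<And>j. j < p \<Longrightarrow> D dvd inv_point p k $ j - inv_point p h $ j"
  have "D dvd ?i (x + (int k - int h)) - ?i x" for x
  proof (rule dvd_all_shifts[of D "\<lambda>x. ?i (x + (int k - int h)) - ?i x" "int h"])
    fix j assume "j < p"
    thus "D dvd ?i (int j + int h + (int k - int h)) - ?i (int j + int h)"
      using D[of j] by (simp add: inv_point_index add.commute)
  next
    fix x y :: int assume xy: "[x = y] (mod (int p))"
    hence "[x + (int k - int h) = y + (int k - int h)] (mod (int p))" by (rule cong_add) simp
    thus "?i (x + (int k - int h)) - ?i x = ?i (y + (int k - int h)) - ?i y"
      using inv_cong xy by simp
  qed
  with not_dvd_diff[OF assms] show "D dvd 1" by (rule no_common_divisor_inv_inv)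
qed simp_all

lemma circ_index_mod:
  assumes "j < p"
  shows "circ_point (p - 1) h $ j = (int j + int h) mod int p"
  using assms circ_point_index[of j "p - 1" h] by (simp add: zmod_int add.commute)

lemma circ_carrier_p: "circ_point (p - 1) h \<in> carrier_vec p"
  using circ_point_carrier[of "p - 1" h] p_gt_1 by simp

lemma circ_circ_visible:
  assumes "h < p" "k < p" "h \<noteq> k"
  shows "mutually_visible (circ_point (p - 1) k) (circ_point (p - 1) h)"
proof (rule mutually_visibleI[OF circ_carrier_p circ_carrier_p])
  fix D assume D: "\<And>j. j < p \<Longrightarrow> D dvd circ_point (p - 1) k $ j - circ_point (p - 1) h $ j"
  have "D dvd (x + (int k - int h)) mod int p - x mod int p" for x
  proof (rule dvd_all_shifts[of D "\<lambda>x. (x + (int k - int h)) mod int p - x mod int p" "int h"])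
    fix j assume j: "j < p"
    have "D dvd (int j + int k) mod int p - (int j + int h) mod int p"
      using D[OF j] by (simp only: circ_index_mod[OF j])
    thus "D dvd (int j + int h + (int k - int h)) mod int p - (int j + int h) mod int p"
      by simp
  next
    fix x y :: int assume xy: "[x = y] (mod (int p))"
    hence "[x + (int k - int h) = y + (int k - int h)] (mod (int p))" by (rule cong_add) simp
    thus "(x + (int k - int h)) mod int p - x mod int p = (y + (int k - int h)) mod int p - y mod int p"
      using xy by (simp add: Cong.cong_def)
  qed
  with not_dvd_diff[OF assms] show "D dvd 1" by (rule no_common_divisor_shift)
qed

lemma circ_inv_visible:
  assumes "13 \<le> p"
  shows "mutually_visible (circ_point (p - 1) h) (inv_point p k)"
proof (rule mutually_visibleI[OF circ_carrier_p inv_point_carrier])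
  let ?i = "modular_inverse (int p)"
  fix D assume D: "\<And>j. j < p \<Longrightarrow> D dvd circ_point (p - 1) h $ j - inv_point p k $ j"
  have dvd: "D dvd (x + (int h - int k)) mod int p - ?i x" for x
  proof (rule dvd_all_shifts[of D "\<lambda>x. (x + (int h - int k)) mod int p - ?i x" "int k"])
    fix j assume j: "j < p"
    have "D dvd (int j + int h) mod int p - ?i (int j + int k)"
      using D[OF j] by (simp only: circ_index_mod[OF j] inv_point_index[OF j] of_nat_add add.commute[of "int k"])
    thus "D dvd (int j + int k + (int h - int k)) mod int p - ?i (int j + int k)"
      by simp
  next
    fix x y :: int assume xy: "[x = y] (mod (int p))"
    hence "[x + (int h - int k) = y + (int h - int k)] (mod (int p))" by (rule cong_add) simp
    thus "(x + (int h - int k)) mod int p - ?i x = (y + (int h - int k)) mod int p - ?i y"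
      using xy inv_cong[OF xy] by (simp add: Cong.cong_def)
  qed
  have "13 \<le> int p" using assms by simp
  from this dvd show "D dvd 1" by (rule no_common_divisor_shift_inv)
qed

end

lemma mutually_visible_sym:
  assumes "v \<in> carrier_vec n" "w \<in> carrier_vec n" "mutually_visible v w"
  shows "mutually_visible w v"
proof (rule mutually_visibleI[OF assms(2,1)])
  fix D assume D: "\<And>j. j < n \<Longrightarrow> D dvd w $ j - v $ j"
  have "D dvd Gcd (vec_set (v - w))"
  proof (rule Gcd_greatest)
    fix x assume "x \<in> vec_set (v - w)"
    then obtain j where j: "j < n" "x = v $ j - w $ j"
      using assms(1,2) by (auto simp: vec_set_def)
    have "D dvd - (w $ j - v $ j)" unfolding dvd_minus_iff by (rule D[OF j(1)])
    thus "D dvd x" by (simp only: j(2) minus_diff_eq)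
  qed
  thus "D dvd 1" using assms(3) by (simp only: mutually_visible_def)
qed

theorem theorem4:
  shows
    "(\<forall>d p. d \<ge> 2 \<and> prime p \<longrightarrow>
        (\<forall>v \<in> circ_set d \<union> inv_set p. visible_from_origin v) \<and>
        (\<forall>v \<in> inv_set p. \<forall>w \<in> inv_set p. v \<noteq> w \<longrightarrow> mutually_visible v w)) \<and>
     (\<exists>P. \<forall>p \<ge> P. prime p \<longrightarrow>
        (\<forall>v \<in> circ_set (p - 1) \<union> inv_set p. \<forall>w \<in> circ_set (p - 1) \<union> inv_set p.
           v \<noteq> w \<longrightarrow> mutually_visible v w)) \<and>
     limit_set {d. d \<ge> 2}
       (\<lambda>d. {normalized_dist d v w | v w. v \<in> circ_set d \<and> w \<in> circ_set d \<and> v \<noteq> w})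
       = {0..1 / 2} \<and>
     limit_set {p. prime p}
       (\<lambda>p. {normalized_dist (p - 1) v w | v w. v \<in> inv_set p \<and> w \<in> inv_set p \<and> v \<noteq> w})
       = {1 / sqrt 6} \<and>
     limit_set {p. prime p \<and> p - 1 \<ge> 2}
       (\<lambda>p. {normalized_dist (p - 1) v w | v w. v \<in> circ_set (p - 1) \<and> w \<in> inv_set p})
       = {1 / sqrt 6} \<and>
     limit_set {d. d \<ge> 2} (\<lambda>d. Spec (circ_set d)) = {0..sqrt 39 / 8} \<and>
     limit_set {p. prime p} (\<lambda>p. Spec (inv_set p)) = {sqrt 7 / 4} \<and>
     limit_set {p. prime p \<and> p - 1 \<ge> 2} (\<lambda>p. Spec2 (circ_set (p - 1)) (inv_set p))
       = {sqrt 7 / 4}"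
proof (intro conjI)
  show "\<forall>d p. d \<ge> 2 \<and> prime p \<longrightarrow>
        (\<forall>v \<in> circ_set d \<union> inv_set p. visible_from_origin v) \<and>
        (\<forall>v \<in> inv_set p. \<forall>w \<in> inv_set p. v \<noteq> w \<longrightarrow> mutually_visible v w)"
  proof (intro allI impI conjI ballI)
    fix d p :: nat and v assume dp: "d \<ge> 2 \<and> prime p" and v: "v \<in> circ_set d \<union> inv_set p"
    thus "visible_from_origin v"
      using circ_point_visible[of d] inv_point_visible[of p] by (auto simp: circ_set_def inv_set_def)
  next
    fix d p :: nat and v w
    assume dp: "d \<ge> 2 \<and> prime p" and vw: "v \<in> inv_set p" "w \<in> inv_set p" "v \<noteq> w"
    obtain h k where hk: "h < p" "k < p" and eq: "v = inv_point p k" "w = inv_point p h"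
      using vw(1,2) by (auto simp: inv_set_def)
    have "h \<noteq> k" using vw(3) eq by auto
    from inv_inv_visible[OF _ hk this] show "mutually_visible v w" using dp by (simp only: eq)
  qed
  show "\<exists>P. \<forall>p \<ge> P. prime p \<longrightarrow>
        (\<forall>v \<in> circ_set (p - 1) \<union> inv_set p. \<forall>w \<in> circ_set (p - 1) \<union> inv_set p.
           v \<noteq> w \<longrightarrow> mutually_visible v w)"
  \<comment> \<open>The threshold is that of the mixed pairs.\<close>
  proof (intro exI[of _ 13] allI impI ballI)
    fix p :: nat and v w
    assume p: "13 \<le> p" "prime p" and v: "v \<in> circ_set (p - 1) \<union> inv_set p"
      and w: "w \<in> circ_set (p - 1) \<union> inv_set p" and vw: "v \<noteq> w"
    have points: "\<exists>h<p. u = circ_point (p - 1) h \<or> u = inv_point p h"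
      if "u \<in> circ_set (p - 1) \<union> inv_set p" for u
    proof -
      have "{0..p - 1} = {0..<p}" using p by auto
      thus ?thesis using that by (auto simp: circ_set_def inv_set_def)
    qed
    obtain h where h: "h < p" "v = circ_point (p - 1) h \<or> v = inv_point p h" using points[OF v] by blast
    obtain k where k: "k < p" "w = circ_point (p - 1) k \<or> w = inv_point p k" using points[OF w] by blast
    have mixed: "mutually_visible (circ_point (p - 1) a) (inv_point p b)"
      "mutually_visible (inv_point p b) (circ_point (p - 1) a)" for a b
      by (fact circ_inv_visible[OF p(2,1)],
          fact mutually_visible_sym[OF circ_carrier_p[OF p(2)] inv_point_carrier circ_inv_visible[OF p(2,1)]])
    show "mutually_visible v w"
      using h(2) k(2)
    proof (elim disjE)
      assume eq: "v = circ_point (p - 1) h" "w = circ_point (p - 1) k"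
      have "k \<noteq> h" using vw eq by auto
      from circ_circ_visible[OF p(2) k(1) h(1) this] show ?thesis by (simp only: eq)
    next
      assume eq: "v = inv_point p h" "w = inv_point p k"
      have "k \<noteq> h" using vw eq by auto
      from inv_inv_visible[OF p(2) k(1) h(1) this] show ?thesis by (simp only: eq)
    qed (use mixed in simp_all)
  qed
  let ?QG = "\<lambda>p v w. v \<in> inv_set p \<and> w \<in> inv_set p \<and> v \<noteq> w"
  let ?QCG = "\<lambda>p v w. v \<in> circ_set (p - 1) \<and> w \<in> inv_set p"
  have unboundedG: "\<exists>p\<in>{p. prime p}. N \<le> p" for N :: nat
    using bigger_prime[of N] by (auto intro: less_imp_le)
  have unboundedCG: "\<exists>p\<in>{p. prime p \<and> 2 \<le> p - 1}. N \<le> p" for N :: nat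
  proof -
    obtain p where "prime p" "N + 3 < p" using bigger_prime[of "N + 3"] by blast
    thus ?thesis by (intro bexI[of _ p]) auto
  qed
  have nonemptyG: "\<exists>v w. ?QG p v w" if "p \<in> {p. prime p}" for p
  proof -
    have p: "prime p" "1 < p" using that prime_gt_1_nat by auto
    have "inv_point p 0 $ 0 = 0" "inv_point p 1 $ 0 = 1"
      using p inv_point_index[of 0 p] by simp_all
    hence "inv_point p 0 \<noteq> inv_point p 1" by auto
    moreover have "inv_point p 0 \<in> inv_set p" "inv_point p 1 \<in> inv_set p"
      using p by (auto simp: inv_set_def)
    ultimately show ?thesis by blast
  qed
  have nonemptyCG: "\<exists>v w. ?QCG p v w" if "p \<in> {p. prime p \<and> 2 \<le> p - 1}" for p
    using that by (auto simp: circ_set_def inv_set_def)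
  \<comment> \<open>A circulant point may equal an inverse point (for p = 3 the families coincide),
    but of two distinct inverse points at least one differs from it.\<close>
  have nonemptyCG': "\<exists>v w. v \<in> circ_set (p - 1) \<and> w \<in> inv_set p \<and> v \<noteq> w"
    if "p \<in> {p. prime p \<and> 2 \<le> p - 1}" for p
    using nonemptyG[of p] nonemptyCG[OF that] that by blast
  have nuG: "nearly_uncorrelated p v w" if p: "p \<in> {p. prime p}" and Q: "?QG p v w" for p v w
  proof -
    obtain h k where hk: "h < p" "k < p" "v = inv_point p h" "w = inv_point p k"
      using Q by (auto simp: inv_set_def)
    moreover have "h \<noteq> k" using Q hk by blast
    ultimately show ?thesis
      using inv_inv_nearly_uncorrelated[of p k h] not_dvd_diff[of h p k] p by simp
  qed
  have nuCG: "nearly_uncorrelated p v w" if "p \<in> {p. prime p \<and> 2 \<le> p - 1}" "?QCG p v w" for p v w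
    using that circ_inv_nearly_uncorrelated[of p] by (auto simp: circ_set_def inv_set_def)
  show "limit_set {p. prime p}
       (\<lambda>p. {normalized_dist (p - 1) v w | v w. v \<in> inv_set p \<and> w \<in> inv_set p \<and> v \<noteq> w})
       = {1 / sqrt 6}"
    by (rule nearly_uncorrelated_limit_sets(1)[where Q = ?QG, OF unboundedG nonemptyG nuG])
  show "limit_set {p. prime p \<and> p - 1 \<ge> 2}
       (\<lambda>p. {normalized_dist (p - 1) v w | v w. v \<in> circ_set (p - 1) \<and> w \<in> inv_set p})
       = {1 / sqrt 6}"
    by (rule nearly_uncorrelated_limit_sets(1)[where Q = ?QCG, OF unboundedCG nonemptyCG nuCG])
  show "limit_set {p. prime p} (\<lambda>p. Spec (inv_set p)) = {sqrt 7 / 4}"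
    unfolding Spec2_def
    by (rule nearly_uncorrelated_limit_sets(2)[where Q = ?QG, OF unboundedG nonemptyG nuG])
  show "limit_set {p. prime p \<and> p - 1 \<ge> 2} (\<lambda>p. Spec2 (circ_set (p - 1)) (inv_set p)) = {sqrt 7 / 4}"
    unfolding Spec2_def
    by (rule nearly_uncorrelated_limit_sets(2)[where
          Q = "\<lambda>p v w. v \<in> circ_set (p - 1) \<and> w \<in> inv_set p \<and> v \<noteq> w",
          OF unboundedCG nonemptyCG']) (use nuCG in auto)
qed (fact circ_dist_limit_set circ_Spec_limit_set)+

end
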